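(* Let $m,n\ge 1$ be integers. Let $T$ be a triangulated polygon formed from a $(2m+1)$-gon coned off from a center $u_0'$, a $(2n+1)$-gon coned off from a center $v_0'$, and a sequence of adjacent triangles connecting these two polygons, such that $u_0'$ and $v_0'$ are compatible with respect to this sequence of triangles (the construction of $T$ and compatibility are as defined in the context). Then $T$ can be extended to a triangulation of $S^2$ with only two odd vertices; that is, there is a triangulation of $S^2$ containing $T$ as a sub-triangulation of a closed disc (with $u_0'$ and $v_0'$ interior to that disc, and no further subdivision of $T$) and having exactly two vertices of odd degree.
   Context: A triangulation of $S^2$ here means the dual of a finite connected bridgeless trivalent graph embedded in $S^2$; in particular multiple edges are allowed and the three vertices of each triangle are distinct. A vertex is odd if its degree is odd and even if its degree is even. Construction of $T$: consider on $S^2$ two disjoint convex polygons, a $(2m+1)$-gon with boundary vertices $u_1',\dots,u_{2m+1}'$ and center $u_0'$, and a $(2n+1)$-gon with boundary vertices $v_1',\dots,v_{2n+1}'$ and center $v_0'$. Adding the edges $u_0'u_i'$ $(1\le i\le 2m+1)$ and $v_0'v_j'$ $(1\le j\le 2n+1)$ divides these polygons into $2m+1$ and $2n+1$ triangles respectively. The two polygons are connected by a sequence of triangles $\Delta_1,\dots,\Delta_r$ in which consecutive triangles $\Delta_i,\Delta_{i+1}$ share an edge; the triangles $\Delta_1,\dots,\Delta_r$ together form a triangulated rectangle-shaped strip (a disc) without interior vertices, which meets the $(2m+1)$-gon exactly in one edge, say $u_1'u_2'$, which is an edge of $\Delta_1$, and meets the $(2n+1)$-gon exactly in one edge, say $v_1'v_2'$,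 which is an edge of $\Delta_r$. The union of the two coned-off polygons and the strip is a triangulation $T$ of a polygon (closed disc) whose only interior vertices are $u_0'$ and $v_0'$, both of odd degree. Compatibility: color $u_0'$ by $0$ and $u_1',u_2'$ by $1$. Given colors in $\mathbb{Z}_2$ of the two vertices of an edge of a triangle, the color of its third vertex is determined by requiring that the three colors sum to $0$ mod $2$. Proceeding successively through the triangles $u_0'u_1'u_2',\Delta_1,\dots,\Delta_r,v_0'v_1'v_2'$ in this way, one obtains an induced color for $v_0'$. The vertices $u_0'$ and $v_0'$ are compatible with respect to the sequence of triangles if this induced color of $v_0'$ is $0$. *)

theory Defs
  imports
    "Graph_Theory.Bidirected_Digraph"
    "Graph_Theory.Digraph_Component"
    "HOL-Combinatorics.Orbits"
    "HOL-Library.Z2"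
begin

section \<open>Triangulations of the sphere\<close>

(* A finite trivalent graph embedded in the sphere is given, up to homeomorphism, by a
   rotation system: every undirected edge is a pair {a, arev a} of opposite arcs (loops and
   parallel edges are possible), and rot cyclically permutes the three arcs leaving each
   vertex.  The faces are the orbits of rot o arev.  The underlying graph being connected, the
   surface obtained by filling the faces with discs is the sphere iff its Euler
   characteristic is 2. *)

definition faces :: "('t, 'a) pre_digraph \<Rightarrow> ('a \<Rightarrow> 'a) \<Rightarrow> ('a \<Rightarrow> 'a) \<Rightarrow> 'a set set" where
  "faces G arev rot = orbit (rot \<circ> arev) ` arcs G"

definition undirected_edges :: "('t, 'a) pre_digraph \<Rightarrow> ('a \<Rightarrow> 'a) \<Rightarrow> 'a set set" where
  "undirected_edges G arev = (\<lambda>a. {a, arev a}) ` arcs G"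

locale sphere_triangulation = fin_digraph G + bidirected_digraph G arev
  for G :: "('t, 'a) pre_digraph" and arev :: "'a \<Rightarrow> 'a" +
  fixes rot :: "'a \<Rightarrow> 'a"
  assumes connected: "Digraph_Component.connected G"
    and trivalent: "t \<in> verts G \<Longrightarrow> out_degree G t = 3"
    and bridgeless: "a \<in> arcs G \<Longrightarrow>
          Digraph_Component.connected (G\<lparr>arcs := arcs G - {a, arev a}\<rparr>)"
    and rot_permutes: "rot permutes arcs G"
    and rot_cyclic: "t \<in> verts G \<Longrightarrow> cyclic_on rot (out_arcs G t)"
    and spherical: "int (card (verts G)) - int (card (undirected_edges G arev))
          + int (card (faces G arev rot)) = 2"

(* The triangulation is the dual of the embedded graph: its triangles are the vertices of G,
   its edges are the undirected edges of G, its vertices are the faces of G.  The dual of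
   {a, arev a} joins the faces containing a and arev a. *)

definition edge_ends :: "('a \<Rightarrow> 'a) \<Rightarrow> ('a \<Rightarrow> 'a) \<Rightarrow> 'a set \<Rightarrow> 'a set set" where
  "edge_ends arev rot e = orbit (rot \<circ> arev) ` e"

definition triangle_sides :: "('t, 'a) pre_digraph \<Rightarrow> ('a \<Rightarrow> 'a) \<Rightarrow> 't \<Rightarrow> 'a set set" where
  "triangle_sides G arev t = (\<lambda>a. {a, arev a}) ` out_arcs G t"

definition triangle_corners ::
  "('t, 'a) pre_digraph \<Rightarrow> ('a \<Rightarrow> 'a) \<Rightarrow> ('a \<Rightarrow> 'a) \<Rightarrow> 't \<Rightarrow> 'a set set" where
  "triangle_corners G arev rot t = orbit (rot \<circ> arev) ` out_arcs G t"

(* Number of edge ends at the dual vertex x; each arc a accounts for the end of the dual edge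
   {a, arev a} that lies at the face containing a. *)
definition dual_degree ::
  "('t, 'a) pre_digraph \<Rightarrow> ('a \<Rightarrow> 'a) \<Rightarrow> ('a \<Rightarrow> 'a) \<Rightarrow> 'a set \<Rightarrow> nat" where
  "dual_degree G arev rot x = card {a \<in> arcs G. orbit (rot \<circ> arev) a = x}"

definition odd_vertices ::
  "('t, 'a) pre_digraph \<Rightarrow> ('a \<Rightarrow> 'a) \<Rightarrow> ('a \<Rightarrow> 'a) \<Rightarrow> 'a set set" where
  "odd_vertices G arev rot = {x \<in> faces G arev rot. odd (dual_degree G arev rot x)}"


section \<open>Triangulated polygons\<close>

(* A triangulated polygon is represented by its set of triangles, each the set of its three
   vertices. *)

definition edges_of :: "'v set set \<Rightarrow> 'v set set" where
  "edges_of K = {e. card e = 2 \<and> (\<exists>t\<in>K. e \<subseteq> t)}"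

definition link_of :: "'v \<Rightarrow> 'v set set \<Rightarrow> 'v set set" where
  "link_of x K = {t - {x} | t. t \<in> K \<and> x \<in> t}"

definition path_graph :: "'v set set \<Rightarrow> bool" where
  "path_graph E \<longleftrightarrow> (\<exists>xs. distinct xs \<and> 2 \<le> length xs \<and>
     E = {{xs ! i, xs ! Suc i} | i. Suc i < length xs})"

definition cycle_graph :: "'v set set \<Rightarrow> bool" where
  "cycle_graph E \<longleftrightarrow> (\<exists>xs. distinct xs \<and> 3 \<le> length xs \<and>
     E = {{xs ! i, xs ! (Suc i mod length xs)} | i. i < length xs})"

definition interior_vertices :: "'v set set \<Rightarrow> 'v set" where
  "interior_vertices K = {x \<in> \<Union>K. cycle_graph (link_of x K)}"

definition boundary_edges :: "'v set set \<Rightarrow> 'v set set" where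
  "boundary_edges K = {e \<in> edges_of K. \<exists>!t. t \<in> K \<and> e \<subseteq> t}"

(* A connected compact surface with nonempty boundary is a disc iff its Euler characteristic
   is 1. *)
definition triangulated_disc :: "'v set set \<Rightarrow> bool" where
  "triangulated_disc K \<longleftrightarrow>
     finite K \<and> (\<forall>t\<in>K. card t = 3) \<and>
     (\<forall>x\<in>\<Union>K. \<forall>y\<in>\<Union>K. (x, y) \<in> {(a, b). {a, b} \<in> edges_of K}\<^sup>*) \<and>
     (\<forall>x\<in>\<Union>K. path_graph (link_of x K) \<or> cycle_graph (link_of x K)) \<and>
     boundary_edges K \<noteq> {} \<and>
     int (card (\<Union>K)) - int (card (edges_of K)) + int (card K) = 1"

(* The k-gon with boundary vertices p 1, ..., p k, coned off from p 0. *)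
definition coned_polygon :: "nat \<Rightarrow> (nat \<Rightarrow> 'v) \<Rightarrow> 'v set set" where
  "coned_polygon k p = {{p 0, p i, p (i mod k + 1)} | i. i \<in> {1..k}}"

(* The sequence \<Delta> of triangles connects the (2m+1)-gon u and the (2n+1)-gon v.  Since the
   strip meets the u-polygon exactly in the edge u 1 u 2, this edge is on the boundary of the
   strip; likewise for v 1 v 2. *)
definition connecting_strip ::
  "nat \<Rightarrow> nat \<Rightarrow> (nat \<Rightarrow> 'v) \<Rightarrow> (nat \<Rightarrow> 'v) \<Rightarrow> 'v set list \<Rightarrow> bool" where
  "connecting_strip m n u v \<Delta> \<longleftrightarrow>
     inj_on u {0..2*m+1} \<and> inj_on v {0..2*n+1} \<and> u ` {0..2*m+1} \<inter> v ` {0..2*n+1} = {} \<and>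
     distinct \<Delta> \<and>
     (\<forall>i. Suc i < length \<Delta> \<longrightarrow> card (\<Delta> ! i \<inter> \<Delta> ! Suc i) = 2) \<and>
     triangulated_disc (set \<Delta>) \<and> interior_vertices (set \<Delta>) = {} \<and>
     \<Union>(set \<Delta>) \<inter> u ` {0..2*m+1} = {u 1, u 2} \<and>
     {u 1, u 2} \<in> boundary_edges (set \<Delta>) \<and> {u 1, u 2} \<subseteq> hd \<Delta> \<and>
     \<Union>(set \<Delta>) \<inter> v ` {0..2*n+1} = {v 1, v 2} \<and>
     {v 1, v 2} \<in> boundary_edges (set \<Delta>) \<and> {v 1, v 2} \<subseteq> last \<Delta>"

definition connected_polygons ::
  "nat \<Rightarrow> nat \<Rightarrow> (nat \<Rightarrow> 'v) \<Rightarrow> (nat \<Rightarrow> 'v) \<Rightarrow> 'v set list \<Rightarrow> 'v set set" where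
  "connected_polygons m n u v \<Delta> =
     coned_polygon (2*m+1) u \<union> set \<Delta> \<union> coned_polygon (2*n+1) v"


section \<open>Compatibility\<close>

(* Colours in Z/2; None means not yet coloured.  An uncoloured vertex of t whose other two
   vertices are coloured receives their sum, which makes the three colours sum to 0. *)
definition colour_triangle :: "'v set \<Rightarrow> ('v \<Rightarrow> bit option) \<Rightarrow> ('v \<Rightarrow> bit option)" where
  "colour_triangle t c =
     (\<lambda>x. if x \<in> t \<and> c x = None then Some (\<Sum>y\<in>t - {x}. the (c y)) else c x)"

definition induced_colouring ::
  "(nat \<Rightarrow> 'v) \<Rightarrow> (nat \<Rightarrow> 'v) \<Rightarrow> 'v set list \<Rightarrow> ('v \<Rightarrow> bit option)" where
  "induced_colouring u v \<Delta> =
     fold colour_triangle ([{u 0, u 1, u 2}] @ \<Delta> @ [{v 0, v 1, v 2}])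
       [u 0 \<mapsto> 0, u 1 \<mapsto> 1, u 2 \<mapsto> 1]"

definition compatible_centers :: "(nat \<Rightarrow> 'v) \<Rightarrow> (nat \<Rightarrow> 'v) \<Rightarrow> 'v set list \<Rightarrow> bool" where
  "compatible_centers u v \<Delta> \<longleftrightarrow> induced_colouring u v \<Delta> (v 0) = Some 0"


section \<open>Sub-triangulations\<close>

(* K occurs, without further subdivision, as a subcomplex: g, k, h send its vertices, edges
   and triangles injectively to those of the dual triangulation and respect incidence.  The
   map k on edges is needed because an edge of the triangulation is not determined by its end
   points.  The subcomplex is isomorphic to K, so it is a disc if K is one, and it has the same
   interior vertices. *)
definition subtriangulation ::
  "'v set set \<Rightarrow> ('t, 'a) pre_digraph \<Rightarrow> ('a \<Rightarrow> 'a) \<Rightarrow> ('a \<Rightarrow> 'a) \<Rightarrow> bool" where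
  "subtriangulation K G arev rot \<longleftrightarrow>
     (\<exists>(g :: 'v \<Rightarrow> 'a set) (k :: 'v set \<Rightarrow> 'a set) (h :: 'v set \<Rightarrow> 't).
        inj_on g (\<Union>K) \<and> g ` \<Union>K \<subseteq> faces G arev rot \<and>
        inj_on k (edges_of K) \<and> k ` edges_of K \<subseteq> undirected_edges G arev \<and>
        inj_on h K \<and> h ` K \<subseteq> verts G \<and>
        (\<forall>e\<in>edges_of K. edge_ends arev rot (k e) = g ` e) \<and>
        (\<forall>t\<in>K. triangle_corners G arev rot (h t) = g ` t \<and>
                triangle_sides G arev (h t) = k ` edges_of {t}))"

end

theory Submission
  imports Defs
begin

text \<open>
Colour $u_0$ by 0, its neighbours on the polygon by 1, and continue through the strip so that the
colours of each triangle sum to 0. Every triangle of the strip then has exactly one vertex of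
colour 0, so the strip is a chain of fans around its vertices of colour 0; one passes from a fan to
the next through an edge whose ends both have colour 1, and to the next triangle of the same fan
through an edge at the centre. Compatibility says that $v_1 v_2$ is an edge of the first kind, so
that the second polygon is one more fan, with centre $v_0$, at the end of the chain.

A sphere is grown together with $T$. At every moment the part of $T$ met so far lies in a
triangulated sphere that has one more distinguished vertex, called \<open>outer\<close>, on the far side of $T$.
Two moves suffice.
  \<^item> Subdividing an edge whose opposite vertices are \<open>z\<close> and \<open>w\<close> changes the parity of the degree
    at \<open>z\<close> and \<open>w\<close> and nowhere else; the new vertex has degree 4.
  \<^item> An ear replaces a triangle \<open>w p q\<close> by five triangles on the new vertices \<open>z\<close> and \<open>x\<close>, so that
    \<open>z p q\<close> is a triangle and \<open>z\<close> has the three neighbours \<open>p\<close>, \<open>q\<close>, \<open>x\<close>. Among the old vertices only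
    \<open>w\<close> changes parity, and of the new ones only \<open>z\<close> is odd.
With \<open>outer\<close> in the place of \<open>w\<close>, a subdivision adds a further triangle to the fan around \<open>z\<close>, and an
ear opens a new fan with centre \<open>z\<close>. A dummy vertex \<open>x\<close> closes each fan up behind the part that belongs to $T$, and when a fan
is left with an odd centre, one more subdivision by a dummy vertex makes the centre even. The first
polygon and its cone from \<open>outer\<close> form a bipyramid with the odd vertices $u_0$ and \<open>outer\<close>. Along the
strip the odd vertices are therefore $u_0$ and exactly one of \<open>outer\<close> and the current centre, and
after the second polygon, whose size is odd, they are $u_0$ and $v_0$.

Three ingredients make this precise. A triangulated sphere is a set of oriented triangles with
cyclic vertex links, connected, and of the right Euler characteristic; removing a small disc and
coning off its boundary preserves this (\<open>star_disc\<close>), which gives both moves. Its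
dual has the oriented edges as arcs, the face of an arc being determined by the tail of the edge
(\<open>orbit_e\<close>); this yields \<open>sphere_triangulation_G\<close> and \<open>subtriangulation_G\<close>. Finally, a count of
incidences shows that a strip without interior vertices has two vertices more than triangles
(\<open>card_Union_disc\<close>), so that each triangle of the strip adds exactly one new vertex, as the moves do.
\<close>

section \<open>Triangulated spheres as sets of oriented triangles\<close>

definition transitive_on_domain :: "('a \<times> 'a) set \<Rightarrow> bool" where
  "transitive_on_domain R \<longleftrightarrow> (\<forall>x\<in>Domain R. \<forall>y\<in>Domain R. (x, y) \<in> R\<^sup>*)"

definition rotations :: "'a \<Rightarrow> 'a \<Rightarrow> 'a \<Rightarrow> ('a \<times> 'a \<times> 'a) set" where
  "rotations a b c = {(a, b, c), (b, c, a), (c, a, b)}"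

text \<open>For oriented triangles \<open>S\<close>, a pair \<open>(b, c)\<close> of the link means that \<open>c\<close> follows \<open>b\<close> in the
rotation of the neighbours of \<open>a\<close>.\<close>
definition link :: "('a \<times> 'a \<times> 'a) set \<Rightarrow> 'a \<Rightarrow> ('a \<times> 'a) set" where
  "link S a = {(b, c). (a, b, c) \<in> S}"

definition skeleton :: "('a \<times> 'a \<times> 'a) set \<Rightarrow> ('a \<times> 'a) set" where
  "skeleton S = {(a, b). \<exists>c. (a, b, c) \<in> S}"

definition triangles :: "('a \<times> 'a \<times> 'a) set \<Rightarrow> 'a set set" where
  "triangles S = (\<lambda>(a, b, c). {a, b, c}) ` S"

text \<open>Each triangle occurs in its three rotations and with one of its two orientations only. Since each
oriented edge determines the third vertex and its opposite is again an edge, the link of a vertex is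
a permutation of the neighbours, and transitivity makes it a single cycle. Thus \<open>S\<close> is a closed
connected surface. It has \<open>card S / 3\<close> triangles and \<open>card S / 2\<close> edges, so \<open>euler\<close> says that the
Euler characteristic is 2.\<close>
locale oriented_sphere =
  fixes S :: "('a \<times> 'a \<times> 'a) set"
  assumes finite_S: "finite S"
    and rotate: "(a, b, c) \<in> S \<Longrightarrow> (b, c, a) \<in> S"
    and third_unique: "(a, b, c) \<in> S \<Longrightarrow> (a, b, d) \<in> S \<Longrightarrow> c = d"
    and opposite: "(a, b, c) \<in> S \<Longrightarrow> \<exists>d. (b, a, d) \<in> S"
    and neq: "(a, b, c) \<in> S \<Longrightarrow> a \<noteq> b"
    and not_mirrored: "(a, b, c) \<in> S \<Longrightarrow> (b, a, c) \<notin> S"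
    and link_transitive: "transitive_on_domain (link S a)"
    and skeleton_transitive: "transitive_on_domain (skeleton S)"
    and euler: "6 * card (Domain S) = card S + 12"

text \<open>A new point \<open>y\<close> that is reached from an old point and leads back to an old point does not disturb
transitivity, provided that the steps of \<open>R\<close> can be simulated in \<open>R'\<close>.\<close>
lemma transitive_on_domain_insert:
  assumes "transitive_on_domain R" and "R \<subseteq> R'\<^sup>*"
    and "Domain R' \<subseteq> insert y (Domain R)"
    and "p \<in> Domain R" "q \<in> Domain R" and "(p, y) \<in> R'\<^sup>*" "(y, q) \<in> R'\<^sup>*"
  shows "transitive_on_domain R'"
proof -
  have R: "(u, v) \<in> R'\<^sup>*" if "u \<in> Domain R" "v \<in> Domain R" for u v
  proof -
    have "(u, v) \<in> R\<^sup>*"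
      using assms(1) that unfolding transitive_on_domain_def by blast
    then show ?thesis
      using rtrancl_subset_rtrancl[OF assms(2)] by blast
  qed
  have "(u, y) \<in> R'\<^sup>*" "(y, u) \<in> R'\<^sup>*" if "u \<in> Domain R" for u
    using R[OF that assms(4)] R[OF assms(5) that] assms(6,7) by (auto intro: rtrancl_trans)
  then show ?thesis
    using R assms(3) unfolding transitive_on_domain_def by (metis insertE rtrancl.rtrancl_refl subsetD)
qed

lemma transitive_on_domain_rename:
  assumes "transitive_on_domain R" and "map_prod f f ` R = R'"
  shows "transitive_on_domain R'"
proof -
  have "(f u, f v) \<in> R'\<^sup>*" if "(u, v) \<in> R\<^sup>*" for u v
    using that
  proof induction
    case (step v w)
    then have "(f v, f w) \<in> R'"
      using assms(2) by force
    with step show ?case by simp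
  qed simp
  moreover have "\<exists>u'\<in>Domain R. u = f u'" if "u \<in> Domain R'" for u
    using that assms(2) by force
  ultimately show ?thesis
    using assms(1) unfolding transitive_on_domain_def by metis
qed

context oriented_sphere
begin

lemma rotate2: "(a, b, c) \<in> S \<Longrightarrow> (c, a, b) \<in> S"
  by (blast intro: rotate)

lemma neqs:
  assumes "(a, b, c) \<in> S"
  shows "a \<noteq> b" "b \<noteq> c" "c \<noteq> a"
  using assms neq rotate by blast+

lemma predecessor_unique: "(a, c, b) \<in> S \<Longrightarrow> (a, d, b) \<in> S \<Longrightarrow> c = d"
  using rotate2 third_unique by blast

lemma in_Domain:
  assumes "(a, b, c) \<in> S"
  shows "a \<in> Domain S" "b \<in> Domain S" "c \<in> Domain S"
  using assms rotate rotate2 by blast+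

lemma finite_Domain_S: "finite (Domain S)"
  using finite_S by (simp add: finite_Domain)

text \<open>The common step of both moves: the triangles \<open>D\<close> are replaced by the cone from a new vertex \<open>y\<close>
over the boundary \<open>B\<close> of \<open>D\<close>. The oriented edges of \<open>B\<close> are those of \<open>D\<close> whose opposite edge is
outside, so they are matched by the cone; the inner edges of \<open>D\<close> disappear in opposite pairs. The
hypothesis \<open>card_B\<close> is the Euler relation of a disc with all its vertices on the boundary: such a disc
has two boundary edges more than triangles. How the links at the old vertices change depends on the
shape of \<open>D\<close> and is left to the caller.\<close>
lemma star_disc:
  assumes D: "D \<subseteq> S" and D_rotate: "\<And>a b c. (a, b, c) \<in> D \<Longrightarrow> (b, c, a) \<in> D"
    and B: "\<And>p q. (p, q) \<in> B \<longleftrightarrow> (p, q) \<in> skeleton D \<and> (q, p) \<notin> skeleton D"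
    and B_unique: "\<And>p q r. (p, q) \<in> B \<Longrightarrow> (p, r) \<in> B \<Longrightarrow> q = r"
    and B_unique': "\<And>p q r. (p, q) \<in> B \<Longrightarrow> (r, q) \<in> B \<Longrightarrow> p = r"
    and B_next: "\<And>p q. (p, q) \<in> B \<Longrightarrow> \<exists>r. (q, r) \<in> B"
    and B_prev: "\<And>p q. (p, q) \<in> B \<Longrightarrow> \<exists>r. (r, p) \<in> B"
    and B_transitive: "transitive_on_domain B"
    and y: "y \<notin> Domain S"
    and links: "\<And>x. x \<noteq> y \<Longrightarrow>
      transitive_on_domain (link S x - link D x \<union> {(q, y) | q. (x, q) \<in> B} \<union> {(y, r) | r. (r, x) \<in> B})"
    and inner: "Domain D \<subseteq> Domain B" and card_B: "3 * card B = card D + 6"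
    and S': "S' = S - D \<union> (\<Union>(p, q)\<in>B. rotations y p q)"
  shows "oriented_sphere S'"
proof
  have ynot: "(y, p, q) \<notin> S" "(p, y, q) \<notin> S" "(p, q, y) \<notin> S" for p q
    using y in_Domain by blast+
  have DS: "(p, q, r) \<in> D \<Longrightarrow> (p, q, r) \<in> S" for p q r
    using D by blast
  have yB: "(p, q) \<in> B \<Longrightarrow> p \<noteq> y \<and> q \<noteq> y \<and> p \<noteq> q" for p q
    using D ynot neq unfolding B skeleton_def by blast
  have in_S': "(p, q, r) \<in> S' \<longleftrightarrow> (p, q, r) \<in> S \<and> (p, q, r) \<notin> D \<or>
      p = y \<and> (q, r) \<in> B \<or> q = y \<and> (r, p) \<in> B \<or> r = y \<and> (p, q) \<in> B" for p q r
    unfolding S' rotations_def by auto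
  have BD: "(p, q) \<in> B \<Longrightarrow> (p, q, r) \<in> S \<Longrightarrow> (p, q, r) \<in> D" for p q r
    using D third_unique unfolding B skeleton_def by blast
  have BD': "(p, q) \<in> B \<Longrightarrow> \<exists>r. (q, p, r) \<in> S \<and> (q, p, r) \<notin> D" for p q
    using D opposite unfolding B skeleton_def by blast
  have B_Domain: "p \<in> Domain S" "q \<in> Domain S" if "(p, q) \<in> B" for p q
    using that in_Domain DS unfolding B skeleton_def by blast+
  then have "finite B"
    by (intro finite_subset[of B "Domain S \<times> Domain S"]) (auto simp: finite_Domain_S)
  then show "finite S'"
    unfolding S' by (auto simp: finite_S rotations_def)
  show "(q, r, p) \<in> S'" if "(p, q, r) \<in> S'" for p q r
  proof -
    have "(q, r, p) \<notin> D" if "(p, q, r) \<notin> D"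
      using that D_rotate by blast
    then show ?thesis
      using that rotate unfolding in_S' by blast
  qed
  show "r = s" if "(p, q, r) \<in> S'" "(p, q, s) \<in> S'" for p q r s
  proof (cases "p = y \<or> q = y")
    case True
    then show ?thesis
      using that ynot yB B_unique B_unique' unfolding in_S' by metis
  next
    case False
    then show ?thesis
      using that BD third_unique unfolding in_S' by metis
  qed
  show "\<exists>s. (q, p, s) \<in> S'" if pqr: "(p, q, r) \<in> S'" for p q r
  proof -
    consider "(p, q, r) \<in> S" "(p, q, r) \<notin> D" | "p = y" "(q, r) \<in> B" | "q = y" "(r, p) \<in> B"
      | "r = y" "(p, q) \<in> B"
      using pqr unfolding in_S' by blast
    then show ?thesis
    proof cases
      case 1
      then obtain s where s: "(q, p, s) \<in> S"
        using opposite by blast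
      show ?thesis
      proof (cases "(q, p, s) \<in> D")
        case True
        moreover have "(p, q) \<notin> skeleton D"
          using 1 D third_unique unfolding skeleton_def by blast
        ultimately have "(q, p) \<in> B"
          unfolding B by (auto simp: skeleton_def)
        then show ?thesis
          unfolding in_S' by blast
      next
        case False
        with s show ?thesis
          unfolding in_S' by blast
      qed
    next
      case 2
      then obtain s where "(s, q) \<in> B"
        using B_prev by blast
      with 2 show ?thesis
        unfolding in_S' by blast
    next
      case 3
      then obtain s where "(p, s) \<in> B"
        using B_next by blast
      with 3 show ?thesis
        unfolding in_S' by blast
    next
      case 4
      then show ?thesis
        using BD' unfolding in_S' by blast
    qed
  qed
  show "p \<noteq> q" if "(p, q, r) \<in> S'" for p q r
    using that neq yB unfolding in_S' by metis
  show "(q, p, r) \<notin> S'" if "(p, q, r) \<in> S'" for p q r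
  proof
    assume qpr: "(q, p, r) \<in> S'"
    have "(s, t) \<in> B \<Longrightarrow> (t, s) \<notin> B" for s t
      unfolding B by blast
    then show False
      using that qpr ynot yB not_mirrored unfolding in_S' by metis
  qed
  show "transitive_on_domain (link S' x)" for x
  proof (cases "x = y")
    case True
    then have "link S' x = B"
      using ynot by (auto simp: link_def in_S' dest: yB)
    then show ?thesis
      using B_transitive by simp
  next
    case False
    have "link S' x = link S x - link D x \<union> {(q, y) | q. (x, q) \<in> B} \<union> {(y, r) | r. (r, x) \<in> B}"
      using False yB ynot unfolding link_def in_S' by auto
    then show ?thesis
      using links[OF False] by simp
  qed
  have B_nonempty: "B \<noteq> {}"
    using card_B by auto
  show "transitive_on_domain (skeleton S')"
  proof -
    obtain p q where pq: "(p, q) \<in> B"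
      using B_nonempty by auto
    have to_y: "(u, y) \<in> skeleton S'" and from_y: "(y, u) \<in> skeleton S'" if "u \<in> Domain B" for u
    proof -
      obtain v where uv: "(u, v) \<in> B"
        using \<open>u \<in> Domain B\<close> by blast
      then obtain r where "(r, u) \<in> B"
        using B_prev by blast
      with uv have "(u, y, r) \<in> S'" "(y, u, v) \<in> S'"
        by (simp_all add: in_S')
      then show "(u, y) \<in> skeleton S'" "(y, u) \<in> skeleton S'"
        by (auto simp: skeleton_def)
    qed
    have "(u, v) \<in> (skeleton S')\<^sup>*" if uv: "(u, v) \<in> skeleton S" for u v
    proof -
      obtain r where r: "(u, v, r) \<in> S"
        using uv unfolding skeleton_def by blast
      show ?thesis
      proof (cases "(u, v, r) \<in> D")
        case True
        then have "u \<in> Domain B" "v \<in> Domain B"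
          using inner D_rotate by blast+
        then show ?thesis
          using to_y from_y by (meson converse_rtrancl_into_rtrancl r_into_rtrancl)
      next
        case False
        with r have "(u, v) \<in> skeleton S'"
          unfolding skeleton_def in_S' by blast
        then show ?thesis ..
      qed
    qed
    moreover have "Domain (skeleton S') \<subseteq> insert y (Domain (skeleton S))"
    proof
      fix u
      assume "u \<in> Domain (skeleton S')"
      then obtain v w where "(u, v, w) \<in> S'"
        by (auto simp: skeleton_def)
      then consider "u \<in> Domain S" | "u = y"
        using B_Domain unfolding in_S' by blast
      then show "u \<in> insert y (Domain (skeleton S))"
        by cases (auto simp: skeleton_def)
    qed
    moreover have "p \<in> Domain (skeleton S)"
      using B_Domain[OF pq] by (auto simp: skeleton_def)
    moreover have "(p, y) \<in> (skeleton S')\<^sup>*" "(y, p) \<in> (skeleton S')\<^sup>*"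
      using pq to_y from_y by blast+
    ultimately show ?thesis
      by (intro transitive_on_domain_insert[OF skeleton_transitive, of _ y p p]) auto
  qed
  show "6 * card (Domain S') = card S' + 12"
  proof -
    have "Domain S' = insert y (Domain S)"
    proof (intro equalityI subsetI)
      fix u
      assume "u \<in> Domain S'"
      then obtain v w where "(u, v, w) \<in> S'"
        by auto
      then show "u \<in> insert y (Domain S)"
        using B_Domain unfolding in_S' by blast
    next
      fix u
      assume u: "u \<in> insert y (Domain S)"
      show "u \<in> Domain S'"
      proof (cases "u = y")
        case True
        obtain p q where "(p, q) \<in> B"
          using B_nonempty by auto
        then have "(y, p, q) \<in> S'"
          by (simp add: in_S')
        then show ?thesis
          using True by blast
      next
        case False
        then obtain v w where uvw: "(u, v, w) \<in> S"
          using u by auto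
        show ?thesis
        proof (cases "(u, v, w) \<in> D")
          case True
          then obtain q where "(u, q) \<in> B"
            using inner by blast
          then have "(u, q, y) \<in> S'"
            by (simp add: in_S')
          then show ?thesis
            by blast
        next
          case False
          with uvw have "(u, v, w) \<in> S'"
            by (simp add: in_S')
          then show ?thesis
            by blast
        qed
      qed
    qed
    then have vertices: "card (Domain S') = Suc (card (Domain S))"
      using y finite_Domain_S by simp
    let ?N = "(\<lambda>(p, q). (y, p, q)) ` B \<union> ((\<lambda>(p, q). (p, q, y)) ` B \<union> (\<lambda>(p, q). (q, y, p)) ` B)"
    have N: "(\<Union>(p, q)\<in>B. rotations y p q) = ?N"
      unfolding rotations_def by auto
    have "card ((\<lambda>(p, q). (y, p, q)) ` B) = card B" "card ((\<lambda>(p, q). (p, q, y)) ` B) = card B"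
      "card ((\<lambda>(p, q). (q, y, p)) ` B) = card B"
      by (auto intro!: card_image inj_onI)
    moreover have "(\<lambda>(p, q). (p, q, y)) ` B \<inter> (\<lambda>(p, q). (q, y, p)) ` B = {}"
      using yB by auto
    moreover have "(\<lambda>(p, q). (y, p, q)) ` B \<inter> ((\<lambda>(p, q). (p, q, y)) ` B \<union> (\<lambda>(p, q). (q, y, p)) ` B) = {}"
      using yB by auto
    ultimately have "card ?N = 3 * card B"
      using \<open>finite B\<close> by (simp add: card_Un_disjoint)
    moreover have "(S - D) \<inter> ?N = {}"
      using ynot by auto
    ultimately have "card S' = card (S - D) + 3 * card B"
      unfolding S' N using finite_S \<open>finite B\<close> by (simp add: card_Un_disjoint)
    moreover have "card (S - D) + card D = card S"
      using D finite_S by (metis card_Diff_subset card_mono finite_subset le_add_diff_inverse2)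
    ultimately show ?thesis
      using vertices card_B euler by simp
  qed
qed

text \<open>The effect on the link of \<open>a\<close> when the edge opposite to \<open>a\<close> in one triangle is broken up by \<open>y\<close>.\<close>
lemma link_insert:
  assumes "(a, b, c) \<in> S"
  shows "transitive_on_domain (link S a - {(b, c)} \<union> {(b, y), (y, c)})"
    (is "transitive_on_domain ?R")
proof (rule transitive_on_domain_insert)
  show "transitive_on_domain (link S a)"
    by (rule link_transitive)
  have "(b, y) \<in> ?R" "(y, c) \<in> ?R"
    by auto
  then show "(b, y) \<in> ?R\<^sup>*" "(y, c) \<in> ?R\<^sup>*"
    by blast+
  then have "(b, c) \<in> ?R\<^sup>*"
    by (rule rtrancl_trans)
  moreover have "x \<in> ?R\<^sup>*" if "x \<in> link S a" "x \<noteq> (b, c)" for x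
    using that by blast
  ultimately show "link S a \<subseteq> ?R\<^sup>*"
    by blast
  show b: "b \<in> Domain (link S a)"
    using assms unfolding link_def by auto
  show "c \<in> Domain (link S a)"
    using opposite[OF rotate2[OF assms]] unfolding link_def by auto
  show "Domain ?R \<subseteq> insert y (Domain (link S a))"
    using b by auto
qed

text \<open>The effect on the link of \<open>a\<close> when the edge from \<open>a\<close> to \<open>b\<close> is cut at \<open>y\<close>: the vertex \<open>y\<close> takes the
place of \<open>b\<close> in the cycle.\<close>
lemma link_rename:
  assumes "(a, b, c) \<in> S" and "(a, d, b) \<in> S" and "y \<notin> Domain S"
  shows "transitive_on_domain (link S a - {(b, c), (d, b)} \<union> {(y, c), (d, y)})"
proof (rule transitive_on_domain_rename[OF link_transitive])
  let ?f = "\<lambda>x. if x = b then y else x"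
  have "?f c = c" "?f d = d"
    using neqs[OF assms(1)] neqs[OF assms(2)] by auto
  then have "map_prod ?f ?f (b, c) = (y, c)" "map_prod ?f ?f (d, b) = (d, y)"
    by simp_all
  moreover have "(b, c) \<in> link S a" "(d, b) \<in> link S a"
    using assms(1,2) by (simp_all add: link_def)
  ultimately have 1: "{(y, c), (d, y)} \<subseteq> map_prod ?f ?f ` link S a"
    by (metis (no_types, lifting) imageI insert_subset empty_subsetI)
  have 2: "link S a - {(b, c), (d, b)} \<subseteq> map_prod ?f ?f ` link S a"
  proof
    fix x
    assume x: "x \<in> link S a - {(b, c), (d, b)}"
    then have "fst x \<noteq> b" "snd x \<noteq> b"
      using third_unique[OF assms(1)] predecessor_unique[OF assms(2)] by (cases x; auto simp: link_def)+
    then have "map_prod ?f ?f x = x"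
      by (cases x) auto
    then show "x \<in> map_prod ?f ?f ` link S a"
      using x image_eqI[of x "map_prod ?f ?f" x "link S a"] by simp
  qed
  have 3: "map_prod ?f ?f x \<in> link S a - {(b, c), (d, b)} \<union> {(y, c), (d, y)}" if x: "x \<in> link S a" for x
  proof (cases "fst x = b \<or> snd x = b")
    case True
    then have "x = (b, c) \<or> x = (d, b)"
      using x third_unique[OF assms(1)] predecessor_unique[OF assms(2)] by (cases x) (auto simp: link_def)
    then show ?thesis
      using \<open>?f c = c\<close> \<open>?f d = d\<close> by auto
  next
    case False
    then show ?thesis
      using x by (cases x) auto
  qed
  show "map_prod ?f ?f ` link S a = link S a - {(b, c), (d, b)} \<union> {(y, c), (d, y)}"
  proof (intro equalityI subsetI)
    fix x
    assume "x \<in> map_prod ?f ?f ` link S a"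
    then obtain x' where "x = map_prod ?f ?f x'" "x' \<in> link S a"
      by (rule imageE)
    then show "x \<in> link S a - {(b, c), (d, b)} \<union> {(y, c), (d, y)}"
      using 3[of x'] by simp
  qed (rule subsetD[OF Un_least[OF 2 1]])
qed

lemma link_outside:
  assumes "x \<noteq> y" and "\<And>b c. (x, b, c) \<notin> D" and "x \<notin> Domain B" and "x \<notin> Range B"
  shows "transitive_on_domain (link S x - link D x \<union> {(q, y) | q. (x, q) \<in> B} \<union> {(y, r) | r. (r, x) \<in> B})"
proof -
  have "link S x - link D x \<union> {(q, y) | q. (x, q) \<in> B} \<union> {(y, r) | r. (r, x) \<in> B} = link S x"
    using assms by (auto simp: link_def)
  then show ?thesis
    using link_transitive by simp
qed

lemma stack:
  assumes abc: "(a, b, c) \<in> S" and y: "y \<notin> Domain S"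
  shows "oriented_sphere (S - rotations a b c \<union> rotations y a b \<union> rotations y b c \<union> rotations y c a)"
proof -
  note nq = neqs[OF abc] neqs[OF abc, symmetric]
  note rot = abc abc[THEN rotate] abc[THEN rotate2]
  define D where "D = rotations a b c"
  define B where "B = {(a, b), (b, c), (c, a)}"
  have links: "transitive_on_domain (link S x - link D x \<union> {(q, y) | q. (x, q) \<in> B} \<union> {(y, r) | r. (r, x) \<in> B})"
    (is "transitive_on_domain ?L")
    if "x \<noteq> y" for x
  proof -
    consider "x = a" | "x = b" | "x = c" | "x \<notin> {a, b, c}"
      by blast
    then show ?thesis
    proof cases
      case 1
      then have "?L = link S x - {(b, c)} \<union> {(b, y), (y, c)}"
        using nq by (auto simp: D_def B_def rotations_def link_def)
      then show ?thesis
        using 1 link_insert[OF rot(1)] by simp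
    next
      case 2
      then have "?L = link S x - {(c, a)} \<union> {(c, y), (y, a)}"
        using nq by (auto simp: D_def B_def rotations_def link_def)
      then show ?thesis
        using 2 link_insert[OF rot(2)] by simp
    next
      case 3
      then have "?L = link S x - {(a, b)} \<union> {(a, y), (y, b)}"
        using nq by (auto simp: D_def B_def rotations_def link_def)
      then show ?thesis
        using 3 link_insert[OF rot(3)] by simp
    next
      case 4
      then show ?thesis
        using that by (intro link_outside) (auto simp: D_def B_def rotations_def)
    qed
  qed
  have B: "(s, t) \<in> B \<longleftrightarrow> (s, t) \<in> skeleton D \<and> (t, s) \<notin> skeleton D" for s t
    using nq by (auto simp: D_def B_def rotations_def skeleton_def)
  have "transitive_on_domain B"
  proof -
    have "(a, b) \<in> B\<^sup>*" "(b, c) \<in> B\<^sup>*" "(c, a) \<in> B\<^sup>*"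
      by (auto simp: B_def)
    then show ?thesis
      unfolding transitive_on_domain_def by (auto simp: B_def intro: rtrancl_trans)
  qed
  moreover have "card D = 3"
    using nq by (simp add: D_def rotations_def)
  moreover have "card B = 3"
    using nq by (simp add: B_def)
  moreover have "D \<subseteq> S"
    using rot by (auto simp: D_def rotations_def)
  moreover have "(s, t, r) \<in> D \<Longrightarrow> (t, r, s) \<in> D" for s t r
    by (auto simp: D_def rotations_def)
  moreover have "Domain D \<subseteq> Domain B"
    by (auto simp: D_def B_def rotations_def)
  moreover have "(s, t) \<in> B \<Longrightarrow> \<exists>r. (t, r) \<in> B" "(s, t) \<in> B \<Longrightarrow> \<exists>r. (r, s) \<in> B" for s t
    by (auto simp: B_def)
  moreover have "(s, t) \<in> B \<Longrightarrow> (s, r) \<in> B \<Longrightarrow> t = r" "(s, t) \<in> B \<Longrightarrow> (r, t) \<in> B \<Longrightarrow> s = r" for s t r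
    using nq by (auto simp: B_def)
  ultimately have "oriented_sphere (S - D \<union> (\<Union>(p, q)\<in>B. rotations y p q))"
    using y by (intro star_disc[OF _ _ B _ _ _ _ _ _ links]) auto
  then show ?thesis
    by (simp add: D_def B_def Un_assoc)
qed

lemma subdivide:
  assumes pqz: "(p, q, z) \<in> S" and qpw: "(q, p, w) \<in> S" and y: "y \<notin> Domain S"
  shows "oriented_sphere (S - (rotations p q z \<union> rotations q p w) \<union>
    (rotations y q z \<union> rotations y z p \<union> rotations y p w \<union> rotations y w q))"
proof -
  have "z \<noteq> w"
    using pqz qpw not_mirrored by blast
  note nq = neqs[OF pqz] neqs[OF pqz, symmetric] neqs[OF qpw] neqs[OF qpw, symmetric] this this[symmetric]
  note rot = pqz pqz[THEN rotate] pqz[THEN rotate2] qpw qpw[THEN rotate] qpw[THEN rotate2]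
  define D where "D = rotations p q z \<union> rotations q p w"
  define B where "B = {(q, z), (z, p), (p, w), (w, q)}"
  have links: "transitive_on_domain (link S x - link D x \<union> {(q, y) | q. (x, q) \<in> B} \<union> {(y, r) | r. (r, x) \<in> B})"
    (is "transitive_on_domain ?L")
    if "x \<noteq> y" for x
  proof -
    consider "x = p" | "x = q" | "x = z" | "x = w" | "x \<notin> {p, q, z, w}"
      by blast
    then show ?thesis
    proof cases
      case 1
      then have "?L = link S x - {(q, z), (w, q)} \<union> {(y, z), (w, y)}"
        using nq by (auto simp: D_def B_def rotations_def link_def)
      then show ?thesis
        using 1 link_rename[OF rot(1) rot(5) y] by simp
    next
      case 2
      then have "?L = link S x - {(p, w), (z, p)} \<union> {(y, w), (z, y)}"
        using nq by (auto simp: D_def B_def rotations_def link_def)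
      then show ?thesis
        using 2 link_rename[OF rot(4) rot(2) y] by simp
    next
      case 3
      then have "?L = link S x - {(p, q)} \<union> {(p, y), (y, q)}"
        using nq by (auto simp: D_def B_def rotations_def link_def)
      then show ?thesis
        using 3 link_insert[OF rot(3)] by simp
    next
      case 4
      then have "?L = link S x - {(q, p)} \<union> {(q, y), (y, p)}"
        using nq by (auto simp: D_def B_def rotations_def link_def)
      then show ?thesis
        using 4 link_insert[OF rot(6)] by simp
    next
      case 5
      then show ?thesis
        using that by (intro link_outside) (auto simp: D_def B_def rotations_def)
    qed
  qed
  have B: "(s, t) \<in> B \<longleftrightarrow> (s, t) \<in> skeleton D \<and> (t, s) \<notin> skeleton D" for s t
    using nq by (auto simp: D_def B_def rotations_def skeleton_def)
  have "transitive_on_domain B"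
  proof -
    have 1: "(q, z) \<in> B\<^sup>*" "(z, p) \<in> B\<^sup>*" "(p, w) \<in> B\<^sup>*" "(w, q) \<in> B\<^sup>*"
      by (auto simp: B_def)
    then have "(q, p) \<in> B\<^sup>*" "(p, q) \<in> B\<^sup>*"
      by (auto intro: rtrancl_trans)
    with 1 show ?thesis
      unfolding transitive_on_domain_def by (auto simp: B_def intro: rtrancl_trans)
  qed
  moreover have "card D = 6"
    using nq by (simp add: D_def rotations_def)
  moreover have "card B = 4"
    using nq by (simp add: B_def)
  moreover have "D \<subseteq> S"
    using rot by (auto simp: D_def rotations_def)
  moreover have "(s, t, r) \<in> D \<Longrightarrow> (t, r, s) \<in> D" for s t r
    by (auto simp: D_def rotations_def)
  moreover have "Domain D \<subseteq> Domain B"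
    by (auto simp: D_def B_def rotations_def)
  moreover have "(s, t) \<in> B \<Longrightarrow> \<exists>r. (t, r) \<in> B" "(s, t) \<in> B \<Longrightarrow> \<exists>r. (r, s) \<in> B" for s t
    by (auto simp: B_def)
  moreover have "(s, t) \<in> B \<Longrightarrow> (s, r) \<in> B \<Longrightarrow> t = r" "(s, t) \<in> B \<Longrightarrow> (r, t) \<in> B \<Longrightarrow> s = r" for s t r
    using nq by (auto simp: B_def)
  ultimately have "oriented_sphere (S - D \<union> (\<Union>(p, q)\<in>B. rotations y p q))"
    using y by (intro star_disc[OF _ _ B _ _ _ _ _ _ links]) auto
  then show ?thesis
    by (simp add: D_def B_def Un_assoc)
qed

end

section \<open>The dual rotation system of a triangulated sphere\<close>

definition degree :: "'a set set \<Rightarrow> 'a \<Rightarrow> nat" where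
  "degree K x = card {t \<in> K. x \<in> t}"

context oriented_sphere
begin

lemma finite_skeleton: "finite (skeleton S)"
proof -
  have "skeleton S = (\<lambda>(a, b, c). (a, b)) ` S"
    by (force simp: skeleton_def)
  then show ?thesis
    by (simp add: finite_S)
qed

lemma trianglesI: "(a, b, c) \<in> S \<Longrightarrow> {a, b, c} \<in> triangles S"
  by (force simp: triangles_def)

lemma trianglesE:
  assumes "t \<in> triangles S"
  obtains a b c where "(a, b, c) \<in> S" "t = {a, b, c}"
  using assms by (auto simp: triangles_def)

lemma finite_triangles: "finite (triangles S)"
  by (simp add: triangles_def finite_S)

text \<open>Unordered triangles lose no information: a vertex set carries only one orientation, so it determines
an oriented triangle up to rotation.\<close>
lemma same_triangle:
  assumes abc: "(a, b, c) \<in> S" and xyz: "(x, y, z) \<in> S" and eq: "{x, y, z} = {a, b, c}"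
  shows "(x, y, z) \<in> rotations a b c"
proof -
  note rots = abc abc[THEN rotate] abc[THEN rotate2]
  have "x \<in> {a, b, c}" "y \<in> {a, b, c}" "z \<in> {a, b, c}"
    using eq by blast+
  then show ?thesis
    using neqs[OF xyz] xyz rots[THEN not_mirrored] by (auto simp: rotations_def)
qed

end

text \<open>The dual graph has the triangles as vertices and the oriented edges as arcs: the arc of \<open>(a, b)\<close>
leaves the triangle on which \<open>(a, b)\<close> lies and crosses to the triangle of \<open>(b, a)\<close>. The injections
\<open>e\<close> and \<open>h\<close> only choose names for arcs and vertices, so that graphs over any large enough types, for
instance the natural numbers, are obtained.\<close>
locale encoded_sphere = oriented_sphere S
  for S :: "('a \<times> 'a \<times> 'a) set" +
  fixes e :: "'a \<times> 'a \<Rightarrow> 'b" and h :: "'a set \<Rightarrow> 't"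
  assumes inj_e: "inj_on e (skeleton S)" and inj_h: "inj_on h (triangles S)"
begin

definition third :: "'a \<Rightarrow> 'a \<Rightarrow> 'a" where
  "third a b = (THE c. (a, b, c) \<in> S)"

definition decode :: "'b \<Rightarrow> 'a \<times> 'a" where
  "decode = inv_into (skeleton S) e"

definition G :: "('t, 'b) pre_digraph" where
  "G = \<lparr>verts = h ` triangles S, arcs = e ` skeleton S,
     tail = (\<lambda>\<alpha>. case decode \<alpha> of (a, b) \<Rightarrow> h {a, b, third a b}),
     head = (\<lambda>\<alpha>. case decode \<alpha> of (a, b) \<Rightarrow> h {b, a, third b a})\<rparr>"

definition arev :: "'b \<Rightarrow> 'b" where
  "arev \<alpha> = (if \<alpha> \<in> e ` skeleton S then case decode \<alpha> of (a, b) \<Rightarrow> e (b, a) else \<alpha>)"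

definition rot :: "'b \<Rightarrow> 'b" where
  "rot \<alpha> = (if \<alpha> \<in> e ` skeleton S then case decode \<alpha> of (a, b) \<Rightarrow> e (b, third a b) else \<alpha>)"

text \<open>The arcs of the oriented edges that leave \<open>a\<close>; these turn out to be the faces of the dual graph.\<close>
definition star :: "'a \<Rightarrow> 'b set" where
  "star a = {e (a, b) | b. (a, b) \<in> skeleton S}"

lemma skeletonI: "(a, b, c) \<in> S \<Longrightarrow> (a, b) \<in> skeleton S"
  by (auto simp: skeleton_def)

lemma third_eq: "(a, b, c) \<in> S \<Longrightarrow> third a b = c"
  unfolding third_def using third_unique by blast

lemma in_S_third: "(a, b) \<in> skeleton S \<Longrightarrow> (a, b, third a b) \<in> S"
  using third_eq by (auto simp: skeleton_def)

lemma skeleton_sym: "(a, b) \<in> skeleton S \<Longrightarrow> (b, a) \<in> skeleton S"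
  using opposite by (auto simp: skeleton_def)

lemma skeleton_neq: "(a, b) \<in> skeleton S \<Longrightarrow> a \<noteq> b"
  using neq by (auto simp: skeleton_def)

lemma decode_e: "(a, b) \<in> skeleton S \<Longrightarrow> decode (e (a, b)) = (a, b)"
  unfolding decode_def using inj_e by simp

lemma e_eq_iff:
  "(a, b) \<in> skeleton S \<Longrightarrow> (c, d) \<in> skeleton S \<Longrightarrow> e (a, b) = e (c, d) \<longleftrightarrow> a = c \<and> b = d"
  using inj_on_eq_iff[OF inj_e] by blast

lemma arcs_G: "arcs G = e ` skeleton S" and verts_G: "verts G = h ` triangles S"
  by (simp_all add: G_def)

lemma arcsE:
  assumes "\<alpha> \<in> arcs G"
  obtains a b where "(a, b) \<in> skeleton S" "\<alpha> = e (a, b)"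
  using assms unfolding arcs_G by fast

lemma tail_e: "(a, b, c) \<in> S \<Longrightarrow> tail G (e (a, b)) = h {a, b, c}"
  by (simp add: G_def decode_e skeletonI third_eq)

lemma head_e: "(b, a, c) \<in> S \<Longrightarrow> head G (e (a, b)) = h {a, b, c}"
  using decode_e[OF skeleton_sym[OF skeletonI[of b a c]]] third_eq[of b a c]
  by (simp add: G_def insert_commute)

lemma arev_e: "(a, b) \<in> skeleton S \<Longrightarrow> arev (e (a, b)) = e (b, a)"
  by (auto simp: arev_def decode_e)

lemma rot_e: "(a, b, c) \<in> S \<Longrightarrow> rot (e (a, b)) = e (b, c)"
  using skeletonI[of a b c] by (auto simp: rot_def decode_e third_eq)

lemma out_arcs_G:
  assumes abc: "(a, b, c) \<in> S"
  shows "out_arcs G (h {a, b, c}) = {e (a, b), e (b, c), e (c, a)}"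
proof (intro equalityI subsetI)
  fix \<alpha>
  assume "\<alpha> \<in> out_arcs G (h {a, b, c})"
  then obtain x y where xy: "(x, y) \<in> skeleton S" "\<alpha> = e (x, y)" "tail G (e (x, y)) = h {a, b, c}"
    by (auto simp: arcs_G)
  have xyz: "(x, y, third x y) \<in> S"
    by (rule in_S_third[OF xy(1)])
  have "h {x, y, third x y} = h {a, b, c}"
    using xy(3) tail_e[OF xyz] by simp
  then have "{x, y, third x y} = {a, b, c}"
    using inj_on_eq_iff[OF inj_h trianglesI[OF xyz] trianglesI[OF abc]] by blast
  then show "\<alpha> \<in> {e (a, b), e (b, c), e (c, a)}"
    using same_triangle[OF abc xyz] xy(2) by (auto simp: rotations_def)
next
  fix \<alpha>
  have "{a, b, c} = {b, c, a}" "{a, b, c} = {c, a, b}"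
    by auto
  moreover assume "\<alpha> \<in> {e (a, b), e (b, c), e (c, a)}"
  ultimately show "\<alpha> \<in> out_arcs G (h {a, b, c})"
    using abc[THEN tail_e] abc[THEN rotate, THEN tail_e] abc[THEN rotate2, THEN tail_e]
      abc[THEN skeletonI] abc[THEN rotate, THEN skeletonI] abc[THEN rotate2, THEN skeletonI]
    by (auto simp: arcs_G)
qed

lemma star_e: "(a, b) \<in> skeleton S \<Longrightarrow> e (a, b) \<in> star a"
  by (auto simp: star_def)

text \<open>Reversing \<open>(a, y)\<close> and rotating inside the triangle of \<open>(y, a)\<close> gives \<open>(a, x)\<close> with \<open>x\<close> just before
\<open>y\<close> in the link of \<open>a\<close>. The face permutation hence walks backwards around the link, which is a single
cycle, and so visits precisely the edges leaving \<open>a\<close>.\<close>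
lemma orbit_e:
  assumes ab: "(a, b) \<in> skeleton S"
  shows "orbit (rot \<circ> arev) (e (a, b)) = star a"
proof -
  let ?f = "rot \<circ> arev"
  have f: "?f (e (a, y)) = e (a, x)" if "(x, y) \<in> link S a" for x y
    using that arev_e[of a y] rot_e[of y a x] rotate2[of a x y] skeleton_sym skeletonI
    by (simp add: link_def)
  have link_prev: "\<exists>x. (x, y) \<in> link S a" if "(a, y) \<in> skeleton S" for y
    using that[THEN skeleton_sym, THEN in_S_third, THEN rotate] by (auto simp: link_def)
  have link_skeleton: "(a, x) \<in> skeleton S" "(a, y) \<in> skeleton S" if "(x, y) \<in> link S a" for x y
    using that[unfolded link_def] skeletonI rotate2 skeleton_sym by blast+
  have reach: "x = b \<or> e (a, x) \<in> orbit ?f (e (a, b))" if "(x, b) \<in> (link S a)\<^sup>*" for x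
    using that
  proof (induction rule: converse_rtrancl_induct)
    case (step x x')
    then show ?case
      using f[OF step(1)] orbit.base[of ?f "e (a, b)"] orbit.step[of "e (a, x')" ?f "e (a, b)"]
      by (auto simp del: comp_apply)
  qed simp
  have Domain: "x \<in> Domain (link S a)" if "(a, x) \<in> skeleton S" for x
    using in_S_third[OF that] by (auto simp: link_def)
  have reach': "x = b \<or> e (a, x) \<in> orbit ?f (e (a, b))" if "(a, x) \<in> skeleton S" for x
    using reach link_transitive[of a] Domain[OF that] Domain[OF ab]
    unfolding transitive_on_domain_def by blast
  show ?thesis
  proof (intro equalityI subsetI)
    fix \<alpha>
    assume "\<alpha> \<in> orbit ?f (e (a, b))"
    then have "\<exists>x. (a, x) \<in> skeleton S \<and> \<alpha> = e (a, x)"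
    proof induction
      case base
      then show ?case
        using link_prev[OF ab] f link_skeleton by metis
    next
      case (step \<alpha>)
      then show ?case
        using link_prev f link_skeleton by metis
    qed
    then show "\<alpha> \<in> star a"
      by (auto simp: star_def)
  next
    fix \<alpha>
    assume "\<alpha> \<in> star a"
    then obtain x where x: "(a, x) \<in> skeleton S" "\<alpha> = e (a, x)"
      by (auto simp: star_def)
    obtain w where w: "(w, b) \<in> link S a"
      using link_prev[OF ab] by blast
    obtain w' where w': "(b, w') \<in> link S a"
      using Domain[OF ab] by blast
    have "e (a, w') \<in> orbit ?f (e (a, b))"
      using reach'[of w'] link_skeleton[OF w'] w' skeleton_neq neqs(2)[of a b w'] by (auto simp: link_def)
    then have "e (a, b) \<in> orbit ?f (e (a, b))"
      using f[OF w'] orbit.step by metis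
    then show "\<alpha> \<in> orbit ?f (e (a, b))"
      using reach'[OF x(1)] x(2) by blast
  qed
qed

lemma Domain_skeleton: "Domain (skeleton S) = Domain S"
  by (auto simp: skeleton_def)

lemma faces_G: "faces G arev rot = star ` Domain S"
proof -
  have "faces G arev rot = (\<lambda>(a, b). orbit (rot \<circ> arev) (e (a, b))) ` skeleton S"
    by (simp add: faces_def arcs_G image_image case_prod_eta)
  also have "\<dots> = (\<lambda>(a, b). star a) ` skeleton S"
    by (rule image_cong) (auto simp: orbit_e simp del: comp_apply)
  also have "\<dots> = star ` Domain (skeleton S)"
    by force
  finally show ?thesis
    by (simp add: Domain_skeleton)
qed

lemma inj_star: "inj_on star (Domain S)"
proof
  fix a a'
  assume a: "a \<in> Domain S" "a' \<in> Domain S" "star a = star a'"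
  then obtain b where ab: "(a, b) \<in> skeleton S"
    unfolding Domain_skeleton[symmetric] by blast
  then obtain b' where "(a', b') \<in> skeleton S" "e (a, b) = e (a', b')"
    using a(3) star_e[OF ab] by (auto simp: star_def)
  then show "a = a'"
    using ab e_eq_iff by blast
qed

lemma dual_degree_star:
  assumes a: "a \<in> Domain S"
  shows "dual_degree G arev rot (star a) = degree (triangles S) a"
proof -
  let ?N = "{b. (a, b) \<in> skeleton S}"
  have "{\<alpha> \<in> arcs G. orbit (rot \<circ> arev) \<alpha> = star a} = (\<lambda>b. e (a, b)) ` ?N"
  proof (intro equalityI subsetI)
    fix \<alpha>
    assume "\<alpha> \<in> {\<alpha> \<in> arcs G. orbit (rot \<circ> arev) \<alpha> = star a}"
    then obtain x y where xy: "(x, y) \<in> skeleton S" "\<alpha> = e (x, y)" "star x = star a"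
      using orbit_e by (auto simp: arcs_G simp del: comp_apply)
    then have "x = a"
      using inj_star a Domain_skeleton by (metis DomainI inj_on_eq_iff)
    then show "\<alpha> \<in> (\<lambda>b. e (a, b)) ` ?N"
      using xy by auto
  qed (auto simp: arcs_G orbit_e simp del: comp_apply)
  then have "dual_degree G arev rot (star a) = card ((\<lambda>b. e (a, b)) ` ?N)"
    by (simp add: dual_degree_def)
  also have "\<dots> = card ?N"
    by (intro card_image inj_onI) (simp add: e_eq_iff)
  also have "\<dots> = card {t \<in> triangles S. a \<in> t}"
  proof (rule bij_betw_same_card[of "\<lambda>b. {a, b, third a b}"], rule bij_betw_imageI)
    show "inj_on (\<lambda>b. {a, b, third a b}) ?N"
    proof
      fix b b'
      assume "b \<in> ?N" "b' \<in> ?N" and eq: "{a, b, third a b} = {a, b', third a b'}"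
      then have b: "(a, b, third a b) \<in> S" "(a, b', third a b') \<in> S"
        using in_S_third by simp_all
      show "b = b'"
        using same_triangle[OF b(2,1) eq] neqs[OF b(2)] by (auto simp: rotations_def)
    qed
    show "(\<lambda>b. {a, b, third a b}) ` ?N = {t \<in> triangles S. a \<in> t}"
    proof (intro equalityI subsetI)
      fix t
      assume "t \<in> {t \<in> triangles S. a \<in> t}"
      then obtain x y z where xyz: "(x, y, z) \<in> S" "t = {x, y, z}" "a \<in> {x, y, z}"
        by (auto elim: trianglesE)
      then obtain b c where "(a, b, c) \<in> S" "t = {a, b, c}"
        using rotate[OF xyz(1)] rotate2[OF xyz(1)] by (auto simp: insert_commute)
      then show "t \<in> (\<lambda>b. {a, b, third a b}) ` ?N"
        using third_eq skeletonI by blast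
    qed (use in_S_third trianglesI in auto)
  qed
  finally show ?thesis
    by (simp add: degree_def)
qed

lemma odd_vertices_G:
  "odd_vertices G arev rot = star ` {a \<in> Domain S. odd (degree (triangles S) a)}"
proof -
  have "odd_vertices G arev rot = star ` {a \<in> Domain S. odd (dual_degree G arev rot (star a))}"
    unfolding odd_vertices_def faces_G by blast
  also have "{a \<in> Domain S. odd (dual_degree G arev rot (star a))} =
      {a \<in> Domain S. odd (degree (triangles S) a)}"
    by (rule Collect_cong) (use dual_degree_star in metis)
  finally show ?thesis .
qed

lemma card_odd_vertices_G:
  "card (odd_vertices G arev rot) = card {a \<in> Domain S. odd (degree (triangles S) a)}"
  unfolding odd_vertices_G by (rule card_image, rule inj_on_subset[OF inj_star]) auto

text \<open>The dual vertex of the triangle on which the oriented edge \<open>(a, b)\<close> lies.\<close>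
definition cell :: "'a \<Rightarrow> 'a \<Rightarrow> 't" where
  "cell a b = h {a, b, third a b}"

lemma cell_rotate: "(a, b, c) \<in> S \<Longrightarrow> cell b c = cell a b"
  using third_eq[of a b c] third_eq[OF rotate[of a b c]] by (simp add: cell_def insert_commute)

text \<open>The triangles around a vertex form a cycle, which stays connected when one of its links is
cut; since neighbouring vertices share a triangle and the 1-skeleton is connected, all triangles remain
connected. With \<open>p = q\<close> nothing is deleted, which gives the connectedness of the whole dual graph.\<close>
lemma connected_delete_edge:
  "Digraph_Component.connected (G\<lparr>arcs := e ` (skeleton S - {(p, q), (q, p)})\<rparr>)"
    (is "Digraph_Component.connected ?H")
proof -
  let ?Q = "(arcs_ends ?H)\<^sup>s"
  have Q: "(cell a b, cell b a) \<in> ?Q" if ab: "(a, b) \<in> skeleton S - {(p, q), (q, p)}" for a b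
  proof -
    have "tail G (e (a, b)) = cell a b" "head G (e (a, b)) = cell b a"
      using ab decode_e by (auto simp: G_def cell_def)
    then have "arc_to_ends ?H (e (a, b)) = (cell a b, cell b a)"
      by (simp add: arc_to_ends_def)
    moreover have "e (a, b) \<in> arcs ?H"
      using ab by simp
    ultimately have "(cell a b, cell b a) \<in> arcs_ends ?H"
      unfolding arcs_ends_def by (metis image_eqI)
    then show ?thesis
      by (simp add: symcl_def)
  qed
  have "sym ?Q"
    by (auto simp: sym_def symcl_def)
  then have sym: "(s, t) \<in> ?Q\<^sup>* \<Longrightarrow> (t, s) \<in> ?Q\<^sup>*" for s t
    by (meson sym_rtrancl symE)
  have around: "(cell a b, cell a b') \<in> ?Q\<^sup>*" if ab: "(a, b) \<in> skeleton S" "(a, b') \<in> skeleton S" for a b b'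
  proof -
    \<comment> \<open>The walk around \<open>a\<close> starts at the deleted edge if there is one, so it need not cross it.\<close>
    define c where "c = (if a = p \<and> (a, q) \<in> skeleton S then q else if a = q \<and> (a, p) \<in> skeleton S then p else b)"
    have c: "(a, c) \<in> skeleton S"
      using ab by (auto simp: c_def)
    have allowed: "(y, a) \<in> skeleton S - {(p, q), (q, p)}" if "(a, y) \<in> skeleton S" "y \<noteq> c" for y
    proof -
      have "(y, a) \<in> skeleton S" "a \<noteq> y"
        using that(1) skeleton_sym skeleton_neq by blast+
      moreover have "(y, a) \<noteq> (p, q)" "(y, a) \<noteq> (q, p)"
        using that \<open>a \<noteq> y\<close> by (auto simp: c_def)
      ultimately show ?thesis
        by blast
    qed
    have from_c: "(cell a c, cell a y) \<in> ?Q\<^sup>*" if "(c, y) \<in> (link S a)\<^sup>*" for y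
      using that
    proof induction
      case (step y y')
      then have yy': "(a, y, y') \<in> S"
        by (simp add: link_def)
      show ?case
      proof (cases "y' = c")
        case False
        have "(a, y') \<in> skeleton S"
          using yy' skeletonI rotate2 skeleton_sym by blast
        then have "(cell y' a, cell a y') \<in> ?Q"
          using Q allowed False by blast
        moreover have "cell y' a = cell a y"
          using cell_rotate[OF rotate2[OF yy']] by simp
        ultimately show ?thesis
          using step.IH by (simp add: rtrancl.rtrancl_into_rtrancl)
      qed simp
    qed simp
    have "y \<in> Domain (link S a)" if "(a, y) \<in> skeleton S" for y
      using that by (auto simp: skeleton_def link_def)
    then have "(c, b) \<in> (link S a)\<^sup>*" "(c, b') \<in> (link S a)\<^sup>*"
      using link_transitive[of a] ab c unfolding transitive_on_domain_def by blast+
    then show ?thesis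
      using from_c sym by (meson rtrancl_trans)
  qed
  have reach: "(cell a b, cell a' b') \<in> ?Q\<^sup>*"
    if "(a, a') \<in> (skeleton S)\<^sup>*" "(a, b) \<in> skeleton S" "(a', b') \<in> skeleton S" for a a' b b'
    using that(1,3)
  proof (induction arbitrary: b')
    case base
    then show ?case
      using around that(2) by blast
  next
    case (step x y)
    then have "(cell a b, cell x y) \<in> ?Q\<^sup>*"
      by blast
    moreover have "(y, third x y) \<in> skeleton S"
      using in_S_third[OF step(2)] rotate skeletonI by blast
    then have "(cell x y, cell y b') \<in> ?Q\<^sup>*"
      using around[OF _ step.prems] cell_rotate[OF in_S_third[OF step(2)]] by metis
    ultimately show ?case
      by (rule rtrancl_trans)
  qed
  have cells: "\<exists>a b. (a, b) \<in> skeleton S \<and> t = cell a b" if "t \<in> verts ?H" for t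
    using that skeletonI third_eq by (auto simp: verts_G cell_def elim!: trianglesE) metis
  have reach': "(s, t) \<in> ?Q\<^sup>*" if st: "s \<in> verts ?H" "t \<in> verts ?H" for s t
  proof -
    obtain a b where "(a, b) \<in> skeleton S" "s = cell a b"
      using cells[OF st(1)] by blast
    moreover obtain a' b' where "(a', b') \<in> skeleton S" "t = cell a' b'"
      using cells[OF st(2)] by blast
    moreover from calculation have "(a, a') \<in> (skeleton S)\<^sup>*"
      using skeleton_transitive unfolding transitive_on_domain_def by blast
    ultimately show ?thesis
      using reach by blast
  qed
  have "arcs_ends ?H \<subseteq> verts ?H \<times> verts ?H"
  proof -
    have "cell a b \<in> verts ?H" if "(a, b) \<in> skeleton S" for a b
      using trianglesI[OF in_S_third[OF that]] by (auto simp: verts_G cell_def)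
    moreover have "arc_to_ends ?H (e (a, b)) = (cell a b, cell b a)" if "(a, b) \<in> skeleton S" for a b
      using decode_e[OF that] by (simp add: arc_to_ends_def G_def cell_def)
    moreover have "\<exists>a b. (a, b) \<in> skeleton S \<and> st = arc_to_ends ?H (e (a, b))" if "st \<in> arcs_ends ?H" for st
      using that by (auto simp: arcs_ends_def)
    ultimately show ?thesis
      using skeleton_sym by (metis SigmaI subsetI)
  qed
  then have Q_verts: "?Q \<subseteq> verts ?H \<times> verts ?H"
    by (auto simp: symcl_def)
  have "(s, t) \<in> rtrancl_on (verts ?H) ?Q" if "s \<in> verts ?H" "(s, t) \<in> ?Q\<^sup>*" for s t
    using that(2)
  proof induction
    case base
    then show ?case
      using that(1) by (rule rtrancl_on.intros)
  next
    case (step t t')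
    then show ?case
      using Q_verts rtrancl_on.intros(2)[of s t "verts ?H" ?Q t'] by blast
  qed
  moreover have "verts ?H \<noteq> {}"
  proof -
    have "S \<noteq> {}"
      using euler by auto
    then show ?thesis
      by (simp add: verts_G triangles_def)
  qed
  ultimately show ?thesis
    unfolding connected_conv using reach' by blast
qed

text \<open>Counting oriented triangles, arcs and undirected edges relates the Euler characteristic of the dual graph
to the relation between vertices and oriented triangles required of \<open>S\<close>.\<close>
lemma card_S_triangles: "card S = 3 * card (triangles S)"
proof -
  have fibre: "{s \<in> S. (\<lambda>(a, b, c). {a, b, c}) s = {a, b, c}} = rotations a b c" if "(a, b, c) \<in> S" for a b c
  proof (intro equalityI subsetI)
    fix s
    assume "s \<in> {s \<in> S. (\<lambda>(a, b, c). {a, b, c}) s = {a, b, c}}"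
    then show "s \<in> rotations a b c"
      using same_triangle[OF that] by (cases s) simp
  next
    fix s
    assume "s \<in> rotations a b c"
    then show "s \<in> {s \<in> S. (\<lambda>(a, b, c). {a, b, c}) s = {a, b, c}}"
      using that rotate[OF that] rotate2[OF that] by (auto simp: rotations_def)
  qed
  have "card S = (\<Sum>t\<in>triangles S. card {s \<in> S. (\<lambda>(a, b, c). {a, b, c}) s = t})"
    using sum.image_gen[OF finite_S, of "\<lambda>_. 1 :: nat" "\<lambda>(a, b, c). {a, b, c}"]
    unfolding triangles_def card_eq_sum .
  also have "\<dots> = (\<Sum>t\<in>triangles S. 3)"
  proof (rule sum.cong[OF refl])
    fix t
    assume "t \<in> triangles S"
    then obtain a b c where abc: "(a, b, c) \<in> S" "t = {a, b, c}"
      by (rule trianglesE)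
    then show "card {s \<in> S. (\<lambda>(a, b, c). {a, b, c}) s = t} = 3"
      using fibre[OF abc(1)] neqs[OF abc(1)] by (simp add: rotations_def)
  qed
  finally show ?thesis
    by simp
qed

lemma card_skeleton: "card (skeleton S) = card S"
proof (rule bij_betw_same_card[of "\<lambda>(a, b). (a, b, third a b)"], rule bij_betw_imageI)
  show "inj_on (\<lambda>(a, b). (a, b, third a b)) (skeleton S)"
    by (auto intro: inj_onI)
  show "(\<lambda>(a, b). (a, b, third a b)) ` skeleton S = S"
  proof (intro equalityI subsetI)
    fix s
    assume "s \<in> S"
    then obtain a b c where s: "s = (a, b, c)" "(a, b, c) \<in> S"
      by (cases s) auto
    then show "s \<in> (\<lambda>(a, b). (a, b, third a b)) ` skeleton S"
      using skeletonI[OF s(2)] third_eq[OF s(2)] by (intro image_eqI[of _ _ "(a, b)"]) simp_all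
  qed (use in_S_third in auto)
qed

lemma card_undirected_edges: "2 * card (undirected_edges G arev) = card (skeleton S)"
proof -
  let ?f = "\<lambda>\<alpha>. {\<alpha>, arev \<alpha>}"
  have fibre: "{\<beta> \<in> arcs G. ?f \<beta> = ?f (e (a, b))} = {e (a, b), e (b, a)}" if "(a, b) \<in> skeleton S" for a b
    using that skeleton_sym[OF that] by (auto simp: arcs_G arev_e doubleton_eq_iff)
  have "finite (arcs G)"
    by (simp add: arcs_G finite_skeleton)
  then have "card (arcs G) = (\<Sum>u\<in>undirected_edges G arev. card {\<beta> \<in> arcs G. ?f \<beta> = u})"
    using sum.image_gen[of "arcs G" "\<lambda>_. 1 :: nat" ?f] by (simp add: undirected_edges_def)
  also have "\<dots> = (\<Sum>u\<in>undirected_edges G arev. 2)"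
  proof (rule sum.cong[OF refl])
    fix u
    assume "u \<in> undirected_edges G arev"
    then obtain \<alpha> where "\<alpha> \<in> arcs G" "u = ?f \<alpha>"
      by (auto simp: undirected_edges_def)
    then obtain a b where ab: "(a, b) \<in> skeleton S" "u = ?f (e (a, b))"
      by (metis arcsE)
    then show "card {\<beta> \<in> arcs G. ?f \<beta> = u} = 2"
      using fibre[OF ab(1)] skeleton_neq[OF ab(1)] e_eq_iff[OF ab(1) skeleton_sym[OF ab(1)]] by simp
  qed
  finally show ?thesis
    using card_image[OF inj_e] by (simp add: arcs_G)
qed

end

context encoded_sphere
begin

theorem sphere_triangulation_G: "sphere_triangulation G arev rot"
proof
  show "tail G \<alpha> \<in> verts G" if "\<alpha> \<in> arcs G" for \<alpha>
    using that tail_e in_S_third trianglesI by (fastforce simp: arcs_G verts_G)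
  show "head G \<alpha> \<in> verts G" if \<alpha>: "\<alpha> \<in> arcs G" for \<alpha>
  proof -
    obtain a b where ab: "(a, b) \<in> skeleton S" "\<alpha> = e (a, b)"
      using \<alpha> by (rule arcsE)
    have "(b, a, third b a) \<in> S"
      by (rule in_S_third[OF skeleton_sym[OF ab(1)]])
    then show ?thesis
      using head_e[of b a "third b a"] trianglesI[of b a "third b a"] ab(2) by (simp add: verts_G insert_commute)
  qed
  show "finite (verts G)" "finite (arcs G)"
    by (simp_all add: arcs_G verts_G finite_skeleton finite_triangles)
  show "\<alpha> \<in> arcs G \<longleftrightarrow> arev \<alpha> \<noteq> \<alpha>" for \<alpha>
  proof
    assume "\<alpha> \<in> arcs G"
    then obtain a b where "(a, b) \<in> skeleton S" "\<alpha> = e (a, b)"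
      by (rule arcsE)
    then show "arev \<alpha> \<noteq> \<alpha>"
      using e_eq_iff skeleton_sym skeleton_neq arev_e by metis
  qed (auto simp: arev_def arcs_G split: if_splits)
  show "arev (arev \<alpha>) = \<alpha>" if "\<alpha> \<in> arcs G" for \<alpha>
    using that skeleton_sym by (auto simp: arcs_G arev_e)
  show "tail G (arev \<alpha>) = head G \<alpha>" if \<alpha>: "\<alpha> \<in> arcs G" for \<alpha>
  proof -
    obtain a b where ab: "(a, b) \<in> skeleton S" "\<alpha> = e (a, b)"
      using \<alpha> by (rule arcsE)
    have "(b, a, third b a) \<in> S"
      by (rule in_S_third[OF skeleton_sym[OF ab(1)]])
    then show ?thesis
      using head_e[of b a "third b a"] tail_e[of b a "third b a"] ab by (simp add: arev_e insert_commute)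
  qed
  show "Digraph_Component.connected G"
  proof -
    have "skeleton S - {(a, a), (a, a)} = skeleton S" for a
      using skeleton_neq by auto
    then have "G\<lparr>arcs := e ` (skeleton S - {(a, a), (a, a)})\<rparr> = G" for a
      by (simp add: G_def)
    then show ?thesis
      using connected_delete_edge by metis
  qed
  show "Digraph_Component.connected (G\<lparr>arcs := arcs G - {\<alpha>, arev \<alpha>}\<rparr>)" if \<alpha>: "\<alpha> \<in> arcs G" for \<alpha>
  proof -
    obtain a b where ab: "(a, b) \<in> skeleton S" "\<alpha> = e (a, b)"
      using \<alpha> by (rule arcsE)
    have "e ` (skeleton S - {(a, b), (b, a)}) = e ` skeleton S - e ` {(a, b), (b, a)}"
      by (rule inj_on_image_set_diff[OF inj_e]) (use ab skeleton_sym in auto)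
    then have "arcs G - {\<alpha>, arev \<alpha>} = e ` (skeleton S - {(a, b), (b, a)})"
      using ab by (simp add: arcs_G arev_e)
    then show ?thesis
      using connected_delete_edge by simp
  qed
  have third_arc: "(b, third a b) \<in> skeleton S" if "(a, b) \<in> skeleton S" for a b
    using in_S_third[OF that] rotate skeletonI by blast
  show "out_degree G t = 3" if t: "t \<in> verts G" for t
  proof -
    obtain a b c where abc: "(a, b, c) \<in> S" "t = h {a, b, c}"
      using t by (auto simp: verts_G elim: trianglesE)
    note sk = abc(1)[THEN skeletonI] abc(1)[THEN rotate, THEN skeletonI] abc(1)[THEN rotate2, THEN skeletonI]
    show ?thesis
      using out_arcs_G[OF abc(1)] neqs[OF abc(1)] abc(2) sk by (simp add: out_degree_def e_eq_iff)
  qed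
  show "rot permutes arcs G"
  proof (rule bij_imp_permutes)
    have "rot ` arcs G \<subseteq> arcs G"
      using rot_e in_S_third third_arc by (fastforce simp: arcs_G)
    moreover have "inj_on rot (arcs G)"
    proof
      fix \<alpha> \<beta>
      assume "\<alpha> \<in> arcs G" "\<beta> \<in> arcs G" and eq: "rot \<alpha> = rot \<beta>"
      then obtain a b c d where ab: "(a, b) \<in> skeleton S" "\<alpha> = e (a, b)"
        and cd: "(c, d) \<in> skeleton S" "\<beta> = e (c, d)"
        by (elim arcsE)
      have "e (b, third a b) = e (d, third c d)"
        using eq ab cd rot_e in_S_third by metis
      then have "b = d" "third a b = third c d"
        using e_eq_iff third_arc ab(1) cd(1) by blast+
      then have "(d, third c d, a) \<in> S" "(d, third c d, c) \<in> S"
        using in_S_third[OF ab(1)] in_S_third[OF cd(1)] rotate by metis+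
      then show "\<alpha> = \<beta>"
        using third_unique \<open>b = d\<close> ab(2) cd(2) by blast
    qed
    ultimately show "bij_betw rot (arcs G) (arcs G)"
      by (simp add: arcs_G finite_skeleton bij_betw_def endo_inj_surj)
    show "rot \<alpha> = \<alpha>" if "\<alpha> \<notin> arcs G" for \<alpha>
      using that by (simp add: rot_def arcs_G)
  qed
  show "cyclic_on rot (out_arcs G t)" if t: "t \<in> verts G" for t
  proof -
    obtain a b c where abc: "(a, b, c) \<in> S" "t = h {a, b, c}"
      using t by (auto simp: verts_G elim: trianglesE)
    have r: "rot (e (a, b)) = e (b, c)" "rot (e (b, c)) = e (c, a)" "rot (e (c, a)) = e (a, b)"
      using abc(1)[THEN rot_e] abc(1)[THEN rotate, THEN rot_e] abc(1)[THEN rotate2, THEN rot_e] by auto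
    have "orbit rot (e (a, b)) = {e (a, b), e (b, c), e (c, a)}"
    proof (intro equalityI subsetI)
      fix \<alpha>
      assume "\<alpha> \<in> orbit rot (e (a, b))"
      then show "\<alpha> \<in> {e (a, b), e (b, c), e (c, a)}"
        by induction (use r in auto)
    next
      have "e (b, c) \<in> orbit rot (e (a, b))"
        using orbit.base[of rot "e (a, b)"] r by simp
      moreover from this have "e (c, a) \<in> orbit rot (e (a, b))"
        using orbit.step[of "e (b, c)" rot "e (a, b)"] r by simp
      moreover from this have "e (a, b) \<in> orbit rot (e (a, b))"
        using orbit.step[of "e (c, a)" rot "e (a, b)"] r by simp
      moreover fix \<alpha>
      assume "\<alpha> \<in> {e (a, b), e (b, c), e (c, a)}"
      ultimately show "\<alpha> \<in> orbit rot (e (a, b))"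
        by blast
    qed
    then show ?thesis
      unfolding cyclic_on_def using out_arcs_G[OF abc(1)] abc(2) by auto
  qed
  show "int (card (verts G)) - int (card (undirected_edges G arev)) + int (card (faces G arev rot)) = 2"
  proof -
    have "card (verts G) = card (triangles S)"
      unfolding verts_G by (rule card_image[OF inj_h])
    moreover have "card (faces G arev rot) = card (Domain S)"
      unfolding faces_G by (rule card_image[OF inj_star])
    ultimately show ?thesis
      using euler card_S_triangles card_skeleton card_undirected_edges by linarith
  qed
qed

text \<open>An injection of the vertices that maps triangles of \<open>K\<close> to triangles of the sphere embeds \<open>K\<close>. Edges
and triangles of the sphere are determined by their vertices, so the maps on edges and triangles
are forced, and their injectivity comes from that of \<open>\<iota>\<close>.\<close>
theorem subtriangulation_G:
  assumes inj: "inj_on \<iota> (\<Union>K)" and K: "(\<lambda>t. \<iota> ` t) ` K \<subseteq> triangles S"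
  shows "subtriangulation K G arev rot"
proof -
  define g where "g x = star (\<iota> x)" for x
  define k where "k E = e ` {(a, b) \<in> skeleton S. {a, b} = \<iota> ` E}" for E
  define h' where "h' t = h (\<iota> ` t)" for t
  have triangle: "\<exists>x y z. t = {x, y, z} \<and> x \<noteq> y \<and> y \<noteq> z \<and> z \<noteq> x \<and> (\<iota> x, \<iota> y, \<iota> z) \<in> S" if t: "t \<in> K" for t
  proof -
    obtain a b c where abc: "(a, b, c) \<in> S" "\<iota> ` t = {a, b, c}"
      using K t trianglesE[of "\<iota> ` t"] by blast
    then obtain x y z where xyz: "x \<in> t" "y \<in> t" "z \<in> t" "\<iota> x = a" "\<iota> y = b" "\<iota> z = c"
      by (metis imageE insertI1 insertI2)
    have "s \<in> {x, y, z}" if "s \<in> t" for s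
    proof -
      have "\<iota> s \<in> {\<iota> x, \<iota> y, \<iota> z}"
        using abc(2) that xyz by blast
      moreover have "\<iota> s = \<iota> r \<Longrightarrow> r \<in> t \<Longrightarrow> s = r" for r
        using inj_onD[OF inj] that t by blast
      ultimately show ?thesis
        using xyz by blast
    qed
    then have "t = {x, y, z}"
      using xyz by blast
    then show ?thesis
      using abc xyz neqs[OF abc(1)] by metis
  qed
  have edge: "\<exists>x y. E = {x, y} \<and> x \<in> \<Union>K \<and> y \<in> \<Union>K \<and> (\<iota> x, \<iota> y) \<in> skeleton S" if E: "E \<in> edges_of K" for E
  proof -
    obtain t where t: "t \<in> K" "E \<subseteq> t" "card E = 2"
      using E by (auto simp: edges_of_def)
    then obtain x y where xy: "E = {x, y}" "x \<noteq> y"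
      by (meson card_2_iff)
    obtain r s u where rsu: "t = {r, s, u}" "(\<iota> r, \<iota> s, \<iota> u) \<in> S"
      using triangle[OF t(1)] by blast
    have "(\<iota> x, \<iota> y) \<in> skeleton S"
      using xy t(2) rsu skeleton_sym rsu(2)[THEN skeletonI] rsu(2)[THEN rotate, THEN skeletonI]
        rsu(2)[THEN rotate2, THEN skeletonI] by auto
    then show ?thesis
      using xy t by blast
  qed
  have k_eq: "k {x, y} = {e (\<iota> x, \<iota> y), e (\<iota> y, \<iota> x)}" if "(\<iota> x, \<iota> y) \<in> skeleton S" for x y
    using that skeleton_sym[OF that] by (auto simp: k_def doubleton_eq_iff)
  have "inj_on g (\<Union>K)" and "g ` \<Union>K \<subseteq> faces G arev rot"
  proof -
    have D: "\<iota> x \<in> Domain S" if "x \<in> \<Union>K" for x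
      using that triangle in_Domain by blast
    then show "g ` \<Union>K \<subseteq> faces G arev rot"
      unfolding faces_G g_def by blast
    show "inj_on g (\<Union>K)"
    proof
      fix x y
      assume xy: "x \<in> \<Union>K" "y \<in> \<Union>K" "g x = g y"
      then have "\<iota> x = \<iota> y"
        using inj_onD[OF inj_star _ D[OF xy(1)] D[OF xy(2)]] by (simp only: g_def)
      then show "x = y"
        using inj_onD[OF inj] xy by blast
    qed
  qed
  moreover have "k ` edges_of K \<subseteq> undirected_edges G arev"
  proof
    fix u
    assume "u \<in> k ` edges_of K"
    then obtain x y where "(\<iota> x, \<iota> y) \<in> skeleton S" "u = k {x, y}"
      using edge by blast
    then show "u \<in> undirected_edges G arev"
      using k_eq arev_e by (auto simp: undirected_edges_def arcs_G)
  qed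
  moreover have "inj_on k (edges_of K)"
  proof
    fix E E'
    assume "E \<in> edges_of K" "E' \<in> edges_of K" and eq: "k E = k E'"
    then obtain x y x' y' where xy: "E = {x, y}" "x \<in> \<Union>K" "y \<in> \<Union>K" "(\<iota> x, \<iota> y) \<in> skeleton S"
      and xy': "E' = {x', y'}" "x' \<in> \<Union>K" "y' \<in> \<Union>K" "(\<iota> x', \<iota> y') \<in> skeleton S"
      using edge by meson
    have "e (\<iota> x, \<iota> y) \<in> {e (\<iota> x', \<iota> y'), e (\<iota> y', \<iota> x')}"
      using eq k_eq xy xy' by auto
    then have "\<iota> x = \<iota> x' \<and> \<iota> y = \<iota> y' \<or> \<iota> x = \<iota> y' \<and> \<iota> y = \<iota> x'"
      using e_eq_iff xy(4) xy'(4) skeleton_sym by blast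
    then have "x = x' \<and> y = y' \<or> x = y' \<and> y = x'"
      using inj_onD[OF inj _ xy(2) xy'(2)] inj_onD[OF inj _ xy(3) xy'(3)]
        inj_onD[OF inj _ xy(2) xy'(3)] inj_onD[OF inj _ xy(3) xy'(2)] by blast
    then show "E = E'"
      using xy(1) xy'(1) by auto
  qed
  moreover have "inj_on h' K" and "h' ` K \<subseteq> verts G"
  proof -
    show "h' ` K \<subseteq> verts G"
      using K by (auto simp: verts_G h'_def)
    show "inj_on h' K"
    proof
      fix t t'
      assume t: "t \<in> K" "t' \<in> K" "h' t = h' t'"
      then have "\<iota> ` t = \<iota> ` t'"
        using inj_onD[OF inj_h, of "\<iota> ` t" "\<iota> ` t'"] K by (auto simp: h'_def)
      moreover have "t \<subseteq> \<Union>K" "t' \<subseteq> \<Union>K"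
        using t by blast+
      ultimately show "t = t'"
        using inj_on_image_eq_iff[OF inj] by blast
    qed
  qed
  moreover have "edge_ends arev rot (k E) = g ` E" if E: "E \<in> edges_of K" for E
  proof -
    obtain x y where xy: "E = {x, y}" "(\<iota> x, \<iota> y) \<in> skeleton S"
      using edge[OF E] by blast
    then show ?thesis
      using k_eq orbit_e skeleton_sym by (simp add: edge_ends_def g_def del: comp_apply)
  qed
  moreover have "triangle_corners G arev rot (h' t) = g ` t \<and> triangle_sides G arev (h' t) = k ` edges_of {t}"
    if t: "t \<in> K" for t
  proof -
    obtain x y z where xyz: "t = {x, y, z}" "x \<noteq> y" "y \<noteq> z" "z \<noteq> x" "(\<iota> x, \<iota> y, \<iota> z) \<in> S"
      using triangle[OF t] by blast
    have out: "out_arcs G (h' t) = {e (\<iota> x, \<iota> y), e (\<iota> y, \<iota> z), e (\<iota> z, \<iota> x)}"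
      using out_arcs_G[OF xyz(5)] xyz(1) by (simp add: h'_def)
    note sk = xyz(5)[THEN skeletonI] xyz(5)[THEN rotate, THEN skeletonI] xyz(5)[THEN rotate2, THEN skeletonI]
    have "edges_of {t} = {{x, y}, {y, z}, {z, x}}"
    proof -
      have "E = {x, y} \<or> E = {y, z} \<or> E = {z, x}" if E: "card E = 2" "E \<subseteq> t" for E
      proof -
        obtain r s where "E = {r, s}" "r \<noteq> s"
          using E(1) by (meson card_2_iff)
        then show ?thesis
          using E(2) xyz(1) by auto
      qed
      then show ?thesis
        using xyz(1-4) by (auto simp: edges_of_def)
    qed
    then have "k ` edges_of {t} = {k {x, y}, k {y, z}, k {z, x}}"
      by simp
    then show ?thesis
      unfolding triangle_corners_def triangle_sides_def out g_def
      using sk xyz(1) by (auto simp: k_eq orbit_e arev_e simp del: comp_apply)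
  qed
  ultimately show ?thesis
    unfolding subtriangulation_def by (intro exI[of _ g] exI[of _ k] exI[of _ h'] conjI ballI) simp_all
qed

end

section \<open>Moves on triangulated spheres and the parity of degrees\<close>

text \<open>Forgetting the orientation makes the moves symmetric in the ends of an edge, and lets given triangles,
which are vertex sets, be compared with those of the sphere.\<close>
definition sphere :: "'a set set \<Rightarrow> bool" where
  "sphere K \<longleftrightarrow> (\<exists>S. oriented_sphere S \<and> triangles S = K)"

lemma triangles_Un: "triangles (S \<union> S') = triangles S \<union> triangles S'"
  by (simp add: triangles_def image_Un)

lemma triangles_rotations: "triangles (rotations a b c) = {{a, b, c}}"
  by (auto simp: triangles_def rotations_def)

lemma (in oriented_sphere) triangles_Diff:
  assumes "(a, b, c) \<in> S"
  shows "triangles (S - rotations a b c) = triangles S - {{a, b, c}}"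
proof (intro equalityI subsetI)
  fix t
  assume "t \<in> triangles (S - rotations a b c)"
  then obtain x y z where xyz: "(x, y, z) \<in> S" "(x, y, z) \<notin> rotations a b c" "t = {x, y, z}"
    by (auto simp: triangles_def)
  then show "t \<in> triangles S - {{a, b, c}}"
    using same_triangle[OF assms xyz(1)] trianglesI[OF xyz(1)] by blast
next
  fix t
  assume t: "t \<in> triangles S - {{a, b, c}}"
  then obtain x y z where xyz: "(x, y, z) \<in> S" "t = {x, y, z}"
    by (auto simp: triangles_def)
  then have "(x, y, z) \<notin> rotations a b c"
    using t by (auto simp: rotations_def)
  then show "t \<in> triangles (S - rotations a b c)"
    using xyz by (force simp: triangles_def)
qed

lemma (in oriented_sphere) Union_triangles: "\<Union>(triangles S) = Domain S"
proof
  show "\<Union>(triangles S) \<subseteq> Domain S"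
    using in_Domain by (auto simp: triangles_def)
  show "Domain S \<subseteq> \<Union>(triangles S)"
    by (force simp: triangles_def)
qed

lemma (in oriented_sphere) oriented_triangle:
  assumes "{a, b, c} \<in> triangles S"
  shows "(a, b, c) \<in> S \<or> (b, a, c) \<in> S"
proof -
  obtain x y z where xyz: "(x, y, z) \<in> S" "{a, b, c} = {x, y, z}"
    using assms by (rule trianglesE)
  have neqs: "x \<noteq> y" "y \<noteq> z" "z \<noteq> x"
    by (fact neqs[OF xyz(1)])+
  then have "card {a, b, c} = 3"
    using xyz(2) by simp
  then have "a \<noteq> b" "b \<noteq> c" "a \<noteq> c"
    by (auto simp: card_insert_if split: if_splits)
  moreover have "a \<in> {x, y, z}" "b \<in> {x, y, z}" "c \<in> {x, y, z}"
    using xyz(2) by blast+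
  ultimately show ?thesis
    using xyz(1) rotate[OF xyz(1)] rotate2[OF xyz(1)] by auto
qed

lemma sphere_finite: "sphere K \<Longrightarrow> finite K"
  using oriented_sphere.finite_S by (auto simp: sphere_def triangles_def)

lemma (in oriented_sphere) triangle_distinct:
  assumes "{a, b, c} \<in> triangles S"
  shows "a \<noteq> b" "b \<noteq> c" "a \<noteq> c"
  using oriented_triangle[OF assms] neqs[of a b c] neqs[of b a c] by auto

lemma (in oriented_sphere) stack_triangles:
  assumes "{a, b, c} \<in> triangles S" and y: "y \<notin> Domain S"
  shows "\<exists>S'. oriented_sphere S' \<and> triangles S' = triangles S - {{a, b, c}} \<union> {{y, a, b}, {y, b, c}, {y, c, a}}"
proof -
  have *: ?thesis if "(r, s, t) \<in> S" "{r, s, t} = {a, b, c}"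
    "{{y, r, s}, {y, s, t}, {y, t, r}} = {{y, a, b}, {y, b, c}, {y, c, a}}" for r s t
  proof -
    have "triangles (S - rotations r s t \<union> rotations y r s \<union> rotations y s t \<union> rotations y t r) =
        triangles S - {{r, s, t}} \<union> {{y, r, s}, {y, s, t}, {y, t, r}}"
      unfolding triangles_Un triangles_Diff[OF that(1)] triangles_rotations by auto
    then show ?thesis
      using stack[OF that(1) y] that(2,3) by auto
  qed
  have "(a, b, c) \<in> S \<or> (b, a, c) \<in> S"
    using oriented_triangle assms(1) by blast
  then show ?thesis
    using *[of a b c] *[of b a c] by (auto simp: insert_commute)
qed

lemma (in oriented_sphere) subdivide_triangles:
  assumes "{p, q, z} \<in> triangles S" "{p, q, w} \<in> triangles S" "z \<noteq> w" and y: "y \<notin> Domain S"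
  shows "\<exists>S'. oriented_sphere S' \<and> triangles S' =
    triangles S - {{p, q, z}, {p, q, w}} \<union> {{y, z, p}, {y, z, q}, {y, w, p}, {y, w, q}}"
proof -
  have *: "\<exists>S'. oriented_sphere S' \<and> triangles S' =
      triangles S - {{r, s, z}, {r, s, w}} \<union> {{y, z, r}, {y, z, s}, {y, w, r}, {y, w, s}}"
    if rsz: "(r, s, z) \<in> S" and rsw: "{r, s, w} \<in> triangles S" for r s
  proof -
    have "(r, s, w) \<notin> S"
      using third_unique[OF rsz] assms(3) by blast
    then have srw: "(s, r, w) \<in> S"
      using oriented_triangle[of r s w] rsw by blast
    let ?D = "S - rotations r s z"
    have D': "triangles (?D - rotations s r w) = triangles ?D - {{s, r, w}}"
    proof (intro equalityI subsetI)
      fix t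
      assume "t \<in> triangles (?D - rotations s r w)"
      then obtain a b c where abc: "(a, b, c) \<in> ?D" "(a, b, c) \<notin> rotations s r w" "t = {a, b, c}"
        by (auto simp: triangles_def)
      have "t \<noteq> {s, r, w}"
        using same_triangle[OF srw, of a b c] abc by blast
      moreover have "t \<in> triangles ?D"
        unfolding triangles_def using abc(1,3) by (intro image_eqI[of _ _ "(a, b, c)"]) simp_all
      ultimately show "t \<in> triangles ?D - {{s, r, w}}"
        by blast
    next
      fix t
      assume t: "t \<in> triangles ?D - {{s, r, w}}"
      then obtain a b c where abc: "(a, b, c) \<in> ?D" "t = {a, b, c}"
        by (auto simp: triangles_def)
      then have "(a, b, c) \<notin> rotations s r w"
        using t by (auto simp: rotations_def)
      then show "t \<in> triangles (?D - rotations s r w)"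
        using abc by (force simp: triangles_def)
    qed
    have D: "triangles (S - (rotations r s z \<union> rotations s r w)) = triangles S - {{r, s, z}, {r, s, w}}"
    proof -
      have "S - (rotations r s z \<union> rotations s r w) = ?D - rotations s r w"
        by blast
      moreover have "{s, r, w} = {r, s, w}"
        by blast
      ultimately have "triangles (S - (rotations r s z \<union> rotations s r w)) = triangles S - {{r, s, z}} - {{r, s, w}}"
        using D' triangles_Diff[OF rsz] by simp
      then show ?thesis
        by blast
    qed
    have "triangles (S - (rotations r s z \<union> rotations s r w) \<union>
        (rotations y s z \<union> rotations y z r \<union> rotations y r w \<union> rotations y w s)) =
        triangles S - {{r, s, z}, {r, s, w}} \<union> {{y, z, r}, {y, z, s}, {y, w, r}, {y, w, s}}"
      unfolding triangles_Un D triangles_rotations by (auto simp: insert_commute)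
    then show ?thesis
      using subdivide[OF rsz srw y] by auto
  qed
  have "(p, q, z) \<in> S \<or> (q, p, z) \<in> S"
    using oriented_triangle assms(1) by blast
  then show ?thesis
    using *[of p q] *[of q p] assms(2) by (auto simp: insert_commute)
qed

lemma sphereE:
  assumes "sphere K"
  obtains S where "oriented_sphere S" "triangles S = K" "Domain S = \<Union>K"
  using assms oriented_sphere.Union_triangles unfolding sphere_def by metis

lemma sphere_distinct:
  assumes "sphere K" "{a, b, c} \<in> K"
  shows "a \<noteq> b" "b \<noteq> c" "a \<noteq> c"
  using assms oriented_sphere.triangle_distinct unfolding sphere_def by metis+

lemma sphere_stack:
  assumes "sphere K" and "{a, b, c} \<in> K" and "y \<notin> \<Union>K"
  shows "sphere (K - {{a, b, c}} \<union> {{y, a, b}, {y, b, c}, {y, c, a}})"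
proof -
  obtain S where "oriented_sphere S" "triangles S = K" "Domain S = \<Union>K"
    using assms(1) by (rule sphereE)
  then show ?thesis
    using oriented_sphere.stack_triangles[of S a b c y] assms(2,3) unfolding sphere_def by simp
qed

lemma sphere_subdivide:
  assumes "sphere K" and "{p, q, z} \<in> K" "{p, q, w} \<in> K" "z \<noteq> w" and "y \<notin> \<Union>K"
  shows "sphere (K - {{p, q, z}, {p, q, w}} \<union> {{y, z, p}, {y, z, q}, {y, w, p}, {y, w, q}})"
proof -
  obtain S where "oriented_sphere S" "triangles S = K" "Domain S = \<Union>K"
    using assms(1) by (rule sphereE)
  then show ?thesis
    using oriented_sphere.subdivide_triangles[of S p q z w y] assms(2-) unfolding sphere_def by simp
qed

lemma degree_exchange:
  assumes "finite K" and "D \<subseteq> K" and "finite N" and "N \<inter> K = {}"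
  shows "degree (K - D \<union> N) x + card {t \<in> D. x \<in> t} = degree K x + card {t \<in> N. x \<in> t}"
proof -
  have "{t \<in> K - D \<union> N. x \<in> t} = {t \<in> K - D. x \<in> t} \<union> {t \<in> N. x \<in> t}"
    by blast
  then have "degree (K - D \<union> N) x = card {t \<in> K - D. x \<in> t} + card {t \<in> N. x \<in> t}"
    unfolding degree_def using assms by (subst card_Un_disjoint[symmetric]) auto
  moreover have "{t \<in> K. x \<in> t} = {t \<in> K - D. x \<in> t} \<union> {t \<in> D. x \<in> t}"
    using assms(2) by blast
  then have "degree K x = card {t \<in> K - D. x \<in> t} + card {t \<in> D. x \<in> t}"
    unfolding degree_def using assms(1) finite_subset[OF assms(2,1)]
    by (subst card_Un_disjoint[symmetric]) auto
  ultimately show ?thesis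
    by simp
qed

lemma degree_outside: "x \<notin> \<Union>K \<Longrightarrow> degree K x = 0"
proof -
  assume "x \<notin> \<Union>K"
  then have "{t \<in> K. x \<in> t} = {}"
    by blast
  then show ?thesis
    by (simp only: degree_def card.empty)
qed

lemma card_filter_sum: "finite N \<Longrightarrow> card {t \<in> N. P t} = (\<Sum>t\<in>N. if P t then 1 else 0)"
  unfolding card_eq_sum by (rule sum.inter_filter)

text \<open>The corners of the stacked triangle gain one triangle each, and the new vertex has degree 3.\<close>
lemma degree_stack:
  assumes "sphere K" and abc: "{a, b, c} \<in> K" and y: "y \<notin> \<Union>K"
  shows "odd (degree (K - {{a, b, c}} \<union> {{y, a, b}, {y, b, c}, {y, c, a}}) x) \<longleftrightarrow>
    odd (degree K x) \<noteq> (x \<in> {y, a, b, c})"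
proof -
  note d = sphere_distinct[OF assms(1,2)]
  have y': "y \<noteq> a" "y \<noteq> b" "y \<noteq> c"
    using abc y by blast+
  have "{{y, a, b}, {y, b, c}, {y, c, a}} \<inter> K = {}"
    using y by blast
  then have "degree (K - {{a, b, c}} \<union> {{y, a, b}, {y, b, c}, {y, c, a}}) x + card {t \<in> {{a, b, c}}. x \<in> t} =
      degree K x + card {t \<in> {{y, a, b}, {y, b, c}, {y, c, a}}. x \<in> t}"
    using abc sphere_finite[OF assms(1)] by (intro degree_exchange) auto
  moreover have "card {t \<in> {{a, b, c}}. x \<in> t} = (if x \<in> {a, b, c} then 1 else 0)"
    by (subst card_filter_sum) auto
  moreover have "{y, a, b} \<noteq> {y, b, c}" "{y, a, b} \<noteq> {y, c, a}" "{y, b, c} \<noteq> {y, c, a}"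
    using d y' by (auto simp: set_eq_iff)
  then have "card {t \<in> {{y, a, b}, {y, b, c}, {y, c, a}}. x \<in> t} =
      (if x = y then 3 else if x \<in> {a, b, c} then 2 else 0)"
    using d y' by (subst card_filter_sum) auto
  moreover have "x = y \<Longrightarrow> degree K x = 0"
    using degree_outside[OF y] by simp
  ultimately show ?thesis
    using y' by (auto split: if_splits)
qed

text \<open>The ends of the subdivided edge keep their degree, the two vertices opposite to it gain one triangle each,
and the new vertex has degree 4.\<close>
lemma degree_subdivide:
  assumes "sphere K" and z: "{p, q, z} \<in> K" and w: "{p, q, w} \<in> K" and "z \<noteq> w" and y: "y \<notin> \<Union>K"
  shows "odd (degree (K - {{p, q, z}, {p, q, w}} \<union> {{y, z, p}, {y, z, q}, {y, w, p}, {y, w, q}}) x) \<longleftrightarrow>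
    odd (degree K x) \<noteq> (x \<in> {z, w})"
proof -
  note d = sphere_distinct[OF assms(1) z] sphere_distinct[OF assms(1) w] \<open>z \<noteq> w\<close>
  have y': "y \<noteq> p" "y \<noteq> q" "y \<noteq> z" "y \<noteq> w"
    using z w y by blast+
  let ?N = "{{y, z, p}, {y, z, q}, {y, w, p}, {y, w, q}}"
  have "?N \<inter> K = {}"
    using y by blast
  then have "degree (K - {{p, q, z}, {p, q, w}} \<union> ?N) x + card {t \<in> {{p, q, z}, {p, q, w}}. x \<in> t} =
      degree K x + card {t \<in> ?N. x \<in> t}"
    using z w sphere_finite[OF assms(1)] by (intro degree_exchange) auto
  moreover have "{p, q, z} \<noteq> {p, q, w}"
    using d by (auto simp: set_eq_iff)
  then have "card {t \<in> {{p, q, z}, {p, q, w}}. x \<in> t} = (if x \<in> {p, q} then 2 else if x \<in> {z, w} then 1 else 0)"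
    using d by (subst card_filter_sum) auto
  moreover have "{y, z, p} \<noteq> {y, z, q}" "{y, z, p} \<noteq> {y, w, p}" "{y, z, p} \<noteq> {y, w, q}"
    "{y, z, q} \<noteq> {y, w, p}" "{y, z, q} \<noteq> {y, w, q}" "{y, w, p} \<noteq> {y, w, q}"
    using d y' by (auto simp: set_eq_iff)
  then have "card {t \<in> ?N. x \<in> t} = (if x = y then 4 else if x \<in> {p, q, z, w} then 2 else 0)"
    using d y' by (subst card_filter_sum) auto
  moreover have "x = y \<Longrightarrow> degree K x = 0"
    using degree_outside[OF y] by simp
  ultimately show ?thesis
    using y' d by (auto split: if_splits)
qed

text \<open>Stack \<open>z\<close> on the triangle \<open>w p q\<close>, then subdivide the edge from \<open>w\<close> to \<open>z\<close> by \<open>x\<close>. The parity changes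
of the two steps at \<open>p\<close> and \<open>q\<close> cancel.\<close>
lemma ear:
  assumes K: "sphere K" and w: "{w, p, q} \<in> K" and "z \<notin> \<Union>K" "x \<notin> \<Union>K" "z \<noteq> x"
  defines "K' \<equiv> K - {{w, p, q}} \<union> {{z, p, q}, {x, p, z}, {x, p, w}, {x, q, z}, {x, q, w}}"
  shows "sphere K'" and "odd (degree K' y) \<longleftrightarrow> odd (degree K y) \<noteq> (y \<in> {z, w})"
proof -
  note d = sphere_distinct[OF K w]
  have zx: "z \<noteq> w" "z \<noteq> p" "z \<noteq> q" "x \<noteq> w" "x \<noteq> p" "x \<noteq> q"
  proof -
    have "w \<in> \<Union>K" "p \<in> \<Union>K" "q \<in> \<Union>K"
      using w by (meson UnionI insertI1 insertI2)+
    then show "z \<noteq> w" "z \<noteq> p" "z \<noteq> q" "x \<noteq> w" "x \<noteq> p" "x \<noteq> q"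
      using assms(3,4) by metis+
  qed
  define L where "L = K - {{w, p, q}} \<union> {{z, w, p}, {z, p, q}, {z, q, w}}"
  have L: "sphere L"
    unfolding L_def by (rule sphere_stack[OF K w assms(3)])
  have L_degree: "odd (degree L y) \<longleftrightarrow> odd (degree K y) \<noteq> (y \<in> {z, w, p, q})" for y
    unfolding L_def by (rule degree_stack[OF K w assms(3)])
  have L_eq: "L = K - {{w, p, q}} \<union> {{w, z, p}, {z, p, q}, {w, z, q}}"
    by (simp add: L_def insert_commute)
  have in_L: "{w, z, p} \<in> L" "{w, z, q} \<in> L" "p \<noteq> q" "x \<notin> \<Union>L"
  proof -
    show "{w, z, p} \<in> L" "{w, z, q} \<in> L"
      by (simp_all add: L_eq)
    show "p \<noteq> q"
      by (fact d)
    have "\<Union>L \<subseteq> \<Union>K \<union> {w, z, p, q}"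
      unfolding L_eq by blast
    then show "x \<notin> \<Union>L"
      using zx assms(4,5) by blast
  qed
  have "w \<notin> {z, p, q}"
    using zx(1) d by simp
  then have "{w, z, p} \<noteq> {z, p, q}" "{w, z, q} \<noteq> {z, p, q}"
    by blast+
  moreover have "{w, z, r} \<notin> K" for r
    using assms(3) by blast
  moreover note L_eq
  moreover have "X - {A} \<union> {B, C, D} - {B, D} = X - {A} \<union> {C}"
    if "B \<notin> X" "D \<notin> X" "B \<noteq> C" "D \<noteq> C" for X and A B C D :: "'a set"
    using that by blast
  ultimately have "L - {{w, z, p}, {w, z, q}} = K - {{w, p, q}} \<union> {{z, p, q}}"
    by presburger
  then have K': "L - {{w, z, p}, {w, z, q}} \<union> {{x, p, w}, {x, p, z}, {x, q, w}, {x, q, z}} = K'"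
    by (simp add: K'_def insert_commute)
  then show "sphere K'"
    using sphere_subdivide[OF L in_L] by simp
  show "odd (degree K' y) \<longleftrightarrow> odd (degree K y) \<noteq> (y \<in> {z, w})"
    using degree_subdivide[OF L in_L, of y] L_degree[of y] zx d unfolding K' by auto
qed

section \<open>Bipyramids and fans\<close>

definition odd_set :: "'a set set \<Rightarrow> 'a set" where
  "odd_set K = {x. odd (degree K x)}"

lemma odd_set_subdivide:
  assumes "sphere K" and "{p, q, z} \<in> K" "{p, q, w} \<in> K" "z \<noteq> w" "y \<notin> \<Union>K"
  shows "odd_set (K - {{p, q, z}, {p, q, w}} \<union> {{y, z, p}, {y, z, q}, {y, w, p}, {y, w, q}}) = sym_diff (odd_set K) {z, w}"
  unfolding odd_set_def using degree_subdivide[OF assms] by blast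

lemma Union_subdivide:
  assumes "{p, q, z} \<in> K" "{p, q, w} \<in> K"
  shows "\<Union>(K - {{p, q, z}, {p, q, w}} \<union> {{y, z, p}, {y, z, q}, {y, w, p}, {y, w, q}}) = insert y (\<Union>K)"
  using assms by auto

lemma odd_set_ear:
  assumes "sphere K" and "{w, p, q} \<in> K" and "z \<notin> \<Union>K" "x \<notin> \<Union>K" "z \<noteq> x"
  shows "odd_set (K - {{w, p, q}} \<union> {{z, p, q}, {x, p, z}, {x, p, w}, {x, q, z}, {x, q, w}}) = sym_diff (odd_set K) {z, w}"
  unfolding odd_set_def using ear(2)[OF assms] by blast

lemma Union_ear:
  assumes "{w, p, q} \<in> K"
  shows "\<Union>(K - {{w, p, q}} \<union> {{z, p, q}, {x, p, z}, {x, p, w}, {x, q, z}, {x, q, w}}) = insert z (insert x (\<Union>K))"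
  using assms by auto

text \<open>The boundary of a tetrahedron is the smallest sphere in which no vertex set carries both orientations.\<close>
lemma tetrahedron:
  assumes "distinct [a, b, c, d]"
  defines "S \<equiv> rotations a b c \<union> rotations a c d \<union> rotations a d b \<union> rotations b d c"
  shows "oriented_sphere S"
proof
  have ne: "a \<noteq> b" "b \<noteq> a" "a \<noteq> c" "c \<noteq> a" "a \<noteq> d" "d \<noteq> a" "b \<noteq> c" "c \<noteq> b" "b \<noteq> d" "d \<noteq> b" "c \<noteq> d" "d \<noteq> c"
    using assms(1) by auto
  have S: "(p, q, r) \<in> S \<longleftrightarrow> (p, q, r) \<in> {(a,b,c),(b,c,a),(c,a,b),(a,c,d),(c,d,a),(d,a,c),(a,d,b),(d,b,a),(b,a,d),
    (b,d,c),(d,c,b),(c,b,d)}" for p q r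
    by (auto simp: S_def rotations_def)
  show "finite S"
    by (simp add: S_def rotations_def)
  show "(q, r, p) \<in> S" if "(p, q, r) \<in> S" for p q r
    using that ne unfolding S by (simp, elim disjE conjE; simp)
  show "r = s" if pqr: "(p, q, r) \<in> S" and pqs: "(p, q, s) \<in> S" for p q r s
    using pqr[unfolded S] pqs ne by (simp, elim disjE conjE; simp add: S)
  show "\<exists>s. (q, p, s) \<in> S" if "(p, q, r) \<in> S" for p q r
    using that ne unfolding S by (simp, elim disjE conjE; simp)
  show "p \<noteq> q" if "(p, q, r) \<in> S" for p q r
    using that ne unfolding S by (simp, elim disjE conjE; simp)
  show "(q, p, r) \<notin> S" if "(p, q, r) \<in> S" for p q r
    using that ne unfolding S by (simp, elim disjE conjE; simp)
  have cycle: "transitive_on_domain {(p, q), (q, r), (r, p)}" for p q r :: 'a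
  proof -
    let ?R = "{(p, q), (q, r), (r, p)}"
    have "(p, q) \<in> ?R\<^sup>*" "(q, r) \<in> ?R\<^sup>*" "(r, p) \<in> ?R\<^sup>*"
      by blast+
    moreover from this have "(p, r) \<in> ?R\<^sup>*" "(q, p) \<in> ?R\<^sup>*" "(r, q) \<in> ?R\<^sup>*"
      by (meson rtrancl_trans)+
    ultimately show ?thesis
      unfolding transitive_on_domain_def by simp
  qed
  show "transitive_on_domain (link S x)" for x
  proof -
    have "link S a = {(b, c), (c, d), (d, b)}" "link S b = {(c, a), (a, d), (d, c)}"
      "link S c = {(a, b), (b, d), (d, a)}" "link S d = {(a, c), (c, b), (b, a)}"
      using ne unfolding link_def S by auto
    moreover have "link S x = {}" if "x \<notin> {a, b, c, d}"
      using that unfolding link_def S by auto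
    moreover have "transitive_on_domain ({} :: ('a \<times> 'a) set)"
      by (simp add: transitive_on_domain_def)
    ultimately show ?thesis
      using cycle by (metis insertE singletonD)
  qed
  show "transitive_on_domain (skeleton S)"
  proof -
    have edge: "(x, y) \<in> skeleton S" if "x \<in> {a, b, c, d}" "y \<in> {a, b, c, d}" "x \<noteq> y" for x y
      using that ne unfolding skeleton_def S by (simp, elim disjE; simp)
    have vertices: "Domain (skeleton S) \<subseteq> {a, b, c, d}"
      unfolding skeleton_def S by auto
    have "(x, y) \<in> (skeleton S)\<^sup>*" if "x \<in> Domain (skeleton S)" "y \<in> Domain (skeleton S)" for x y
    proof (cases "x = y")
      case False
      then show ?thesis
        using edge[OF subsetD[OF vertices that(1)] subsetD[OF vertices that(2)]] by (intro r_into_rtrancl)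
    qed simp
    then show ?thesis
      unfolding transitive_on_domain_def by simp
  qed
  show "6 * card (Domain S) = card S + 12"
  proof -
    have "Domain S = {a, b, c, d}"
      unfolding S_def rotations_def by auto
    moreover have "S = {(a,b,c),(b,c,a),(c,a,b),(a,c,d),(c,d,a),(d,a,c),(a,d,b),(d,b,a),(b,a,d),
      (b,d,c),(d,c,b),(c,b,d)}"
      unfolding S_def rotations_def by auto
    ultimately show ?thesis
      using assms(1) by simp
  qed
qed

lemma sphere_tetrahedron:
  assumes "distinct [a, b, c, d]"
  defines "K \<equiv> {{a, b, c}, {a, c, d}, {a, d, b}, {b, d, c}}"
  shows "sphere K" and "odd_set K = {a, b, c, d}"
proof -
  show "sphere K"
  proof -
    have "triangles (rotations a b c \<union> rotations a c d \<union> rotations a d b \<union> rotations b d c) = K"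
      unfolding triangles_Un triangles_rotations K_def by (simp only: Un_insert_left Un_empty_left)
    then show ?thesis
      unfolding sphere_def using tetrahedron[OF assms(1)] by blast
  qed
  have "d \<notin> {a, b, c}" "b \<notin> {a, c, d}" "c \<notin> {a, d, b}"
    using assms(1) by auto
  then have "{a, b, c} \<noteq> {a, c, d}" "{a, b, c} \<noteq> {a, d, b}" "{a, b, c} \<noteq> {b, d, c}"
    "{a, c, d} \<noteq> {a, d, b}" "{a, c, d} \<noteq> {b, d, c}" "{a, d, b} \<noteq> {b, d, c}"
    by blast+
  then have "degree K x = (if x \<in> {a, b, c, d} then 3 else 0)" for x
    unfolding degree_def K_def using assms(1) by (subst card_filter_sum) auto
  then show "odd_set K = {a, b, c, d}"
    by (auto simp: odd_set_def)
qed

text \<open>Cutting the edge from \<open>z\<close> to \<open>w\<close> of a tetrahedron gives the double cone over a triangle. It is the start of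
the construction: the cone from \<open>z\<close> becomes the first polygon, and \<open>w\<close> is the outer vertex.\<close>
lemma sphere_bipyramid:
  assumes "distinct [z, w, a, b, c]"
  shows "\<exists>K. sphere K \<and> odd_set K = {z, w} \<and> \<Union>K = {z, w, a, b, c} \<and>
    {{z, a, b}, {w, a, b}, {z, b, c}, {w, b, c}, {z, c, a}, {w, c, a}} \<subseteq> K"
proof -
  define T where "T = {{z, w, a}, {z, a, b}, {z, b, w}, {w, b, a}}"
  have d: "distinct [z, w, a, b]"
    using assms by simp
  have T: "sphere T" "odd_set T = {z, w, a, b}"
    unfolding T_def by (rule sphere_tetrahedron[OF d])+
  let ?K = "T - {{z, w, a}, {z, w, b}} \<union> {{c, a, z}, {c, a, w}, {c, b, z}, {c, b, w}}"
  have *: "{z, w, a} \<in> T" "{z, w, b} \<in> T" "a \<noteq> b" "c \<notin> \<Union>T"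
    using assms by (auto simp: T_def insert_commute)
  have "sphere ?K"
    by (rule sphere_subdivide[OF T(1) *])
  moreover have "odd_set ?K = {z, w}"
    unfolding odd_set_subdivide[OF T(1) *] T(2) using assms by auto
  moreover have "\<Union>?K = {z, w, a, b, c}"
    unfolding Union_subdivide[OF *(1,2)] by (auto simp: T_def)
  moreover have "{z, a, b} \<notin> {{z, w, a}, {z, w, b}}" "{w, a, b} \<notin> {{z, w, a}, {z, w, b}}"
    using assms by (auto simp: set_eq_iff)
  then have "{{z, a, b}, {w, a, b}, {z, b, c}, {w, b, c}, {z, c, a}, {w, c, a}} \<subseteq> ?K"
    by (simp add: T_def insert_commute)
  ultimately show ?thesis
    by blast
qed

text \<open>Inserting \<open>f 3\<close>, ..., \<open>f (N - 1)\<close> one after the other into the edge between \<open>f 2\<close> and \<open>f N\<close>, each time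
next to \<open>f N\<close>, turns the two triangles on this edge into fans from \<open>z\<close> and from \<open>w\<close>. There are \<open>N - 3\<close>
insertions, so for an odd polygon no parity changes.\<close>
lemma fan_between:
  fixes f :: "nat \<Rightarrow> 'a"
  assumes K: "sphere K" and z: "{z, f 2, f N} \<in> K" and w: "{w, f 2, f N} \<in> K" and zw: "z \<noteq> w"
    and N: "3 \<le> N" and inj: "inj_on f {2..N}" and fresh: "\<And>i. 3 \<le> i \<Longrightarrow> i < N \<Longrightarrow> f i \<notin> \<Union>K"
  shows "\<exists>K'. sphere K' \<and> K - {{z, f 2, f N}, {w, f 2, f N}} \<subseteq> K' \<and>
    (\<forall>i\<in>{2..<N}. {z, f i, f (Suc i)} \<in> K') \<and> \<Union>K' = \<Union>K \<union> f ` {3..<N} \<and>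
    odd_set K' = (if even N then sym_diff (odd_set K) {z, w} else odd_set K)"
proof -
  have inner: "\<exists>K'. sphere K' \<and> K - {{z, f 2, f N}, {w, f 2, f N}} \<subseteq> K' \<and>
      {z, f l, f N} \<in> K' \<and> {w, f l, f N} \<in> K' \<and>
      (\<forall>i\<in>{2..<l}. {z, f i, f (Suc i)} \<in> K') \<and> \<Union>K' = \<Union>K \<union> f ` {3..l} \<and>
      odd_set K' = (if odd l then sym_diff (odd_set K) {z, w} else odd_set K)"
    if "2 \<le> l" "l < N" for l
    using that
  proof (induction l rule: dec_induct)
    case base
    then show ?case
      using K z w by (intro exI[of _ K]) simp
  next
    case (step l)
    then obtain L where L: "sphere L" "K - {{z, f 2, f N}, {w, f 2, f N}} \<subseteq> L"
      "{z, f l, f N} \<in> L" "{w, f l, f N} \<in> L" "\<forall>i\<in>{2..<l}. {z, f i, f (Suc i)} \<in> L"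
      "\<Union>L = \<Union>K \<union> f ` {3..l}"
      "odd_set L = (if odd l then sym_diff (odd_set K) {z, w} else odd_set K)"
      by auto
    have "f (Suc l) \<notin> f ` {3..l}"
    proof
      assume "f (Suc l) \<in> f ` {3..l}"
      then obtain i where "i \<in> {3..l}" "f (Suc l) = f i"
        by blast
      then show False
        using inj_on_eq_iff[OF inj, of "Suc l" i] step(1,4) by simp
    qed
    then have y: "f (Suc l) \<notin> \<Union>L"
      using fresh[of "Suc l"] step L(6) by auto
    have sides: "{f l, f N, z} \<in> L" "{f l, f N, w} \<in> L"
      using L(3,4) by (simp_all add: insert_commute)
    define L' where "L' = L - {{f l, f N, z}, {f l, f N, w}} \<union>
      {{f (Suc l), z, f l}, {f (Suc l), z, f N}, {f (Suc l), w, f l}, {f (Suc l), w, f N}}"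
    have "sphere L'"
      unfolding L'_def by (rule sphere_subdivide[OF L(1) sides zw y])
    moreover have "K - {{z, f 2, f N}, {w, f 2, f N}} \<subseteq> L'"
    proof -
      have "{f l, f N, z} \<notin> K - {{z, f 2, f N}, {w, f 2, f N}} \<and> {f l, f N, w} \<notin> K - {{z, f 2, f N}, {w, f 2, f N}}"
      proof (cases "l = 2")
        case True
        then show ?thesis
          by (simp add: insert_commute)
      next
        case False
        then have "f l \<notin> \<Union>K"
          using fresh step by simp
        then show ?thesis
          by blast
      qed
      moreover have "A - B \<subseteq> M - {s, t} \<union> M'" if "s \<notin> A - B \<and> t \<notin> A - B" "A - B \<subseteq> M" for A B M M' :: "'a set set" and s t
        using that by blast
      ultimately show ?thesis
        using L(2) unfolding L'_def by presburger
    qed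
    moreover have "{z, f (Suc l), f N} \<in> L'" "{w, f (Suc l), f N} \<in> L'"
      unfolding L'_def by (simp_all add: insert_commute)
    moreover have "{z, f i, f (Suc i)} \<in> L'" if i: "i \<in> {2..<Suc l}" for i
    proof (cases "i = l")
      case True
      then show ?thesis
        unfolding L'_def by (simp add: insert_commute)
    next
      case False
      then have "f N \<noteq> f i" "f N \<noteq> f (Suc i)"
        using inj_on_eq_iff[OF inj, of N i] inj_on_eq_iff[OF inj, of N "Suc i"] i step by auto
      moreover have "f N \<noteq> z"
        using sphere_distinct[OF L(1) L(3)] by blast
      ultimately have "{z, f i, f (Suc i)} \<noteq> {f l, f N, z}" "{z, f i, f (Suc i)} \<noteq> {f l, f N, w}"
        by blast+
      moreover have "{z, f i, f (Suc i)} \<in> L"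
        using L(5) i False by simp
      ultimately show ?thesis
        unfolding L'_def by blast
    qed
    moreover have "\<Union>L' = \<Union>K \<union> f ` {3..Suc l}"
      using step(1) L(6) unfolding L'_def Union_subdivide[OF sides] by (auto simp: atLeastAtMostSuc_conv)
    moreover have "odd_set L' = (if odd (Suc l) then sym_diff (odd_set K) {z, w} else odd_set K)"
      unfolding L'_def odd_set_subdivide[OF L(1) sides zw y] L(7) by auto
    ultimately show ?case
      by blast
  qed
  have l: "2 \<le> N - 1" "N - 1 < N" "Suc (N - 1) = N"
    using N by auto
  obtain L where L: "sphere L" "K - {{z, f 2, f N}, {w, f 2, f N}} \<subseteq> L"
      "{z, f (N - 1), f N} \<in> L" "\<forall>i\<in>{2..<N - 1}. {z, f i, f (Suc i)} \<in> L"
      "\<Union>L = \<Union>K \<union> f ` {3..N - 1}"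
      "odd_set L = (if odd (N - 1) then sym_diff (odd_set K) {z, w} else odd_set K)"
    using inner[OF l(1,2)] by blast
  have "{z, f i, f (Suc i)} \<in> L" if "i \<in> {2..<N}" for i
    using that L(3,4) l(3) by (cases "i = N - 1") auto
  moreover have "{3..N - 1} = {3..<N}"
    using N by auto
  moreover have "odd (N - 1) \<longleftrightarrow> even N"
    using N by simp
  ultimately show ?thesis
    using L by metis
qed

section \<open>Realizing a triangulated sphere as a dual\<close>

text \<open>The two descriptions of triangulated spheres meet here: degrees in the dual sense are numbers of
incident triangles, and finiteness supplies names in the natural numbers.\<close>
theorem sphere_realization:
  fixes K :: "'a set set" and T :: "'v set set" and \<iota> :: "'v \<Rightarrow> 'a"
  assumes K: "sphere K" and inj: "inj_on \<iota> (\<Union>T)" and T: "(\<lambda>t. \<iota> ` t) ` T \<subseteq> K"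
  shows "\<exists>(G :: (nat, nat) pre_digraph) arev rot. sphere_triangulation G arev rot \<and>
    subtriangulation T G arev rot \<and> card (odd_vertices G arev rot) = card (odd_set K)"
proof -
  obtain S where S: "oriented_sphere S" "triangles S = K" "Domain S = \<Union>K"
    using K by (rule sphereE)
  obtain e :: "'a \<times> 'a \<Rightarrow> nat" where e: "inj_on e (skeleton S)"
    using finite_imp_inj_to_nat_seg[OF oriented_sphere.finite_skeleton[OF S(1)]] by metis
  obtain h :: "'a set \<Rightarrow> nat" where h: "inj_on h (triangles S)"
    using finite_imp_inj_to_nat_seg[OF oriented_sphere.finite_triangles[OF S(1)]] by metis
  have enc: "encoded_sphere S e h"
    using S(1) e h by (intro encoded_sphere.intro encoded_sphere_axioms.intro)
  have "odd_set K = {a \<in> Domain S. odd (degree (triangles S) a)}"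
    using degree_outside[of _ K] unfolding odd_set_def S by fastforce
  then have "card (odd_vertices (encoded_sphere.G S e h) (encoded_sphere.arev S e) (encoded_sphere.rot S e)) = card (odd_set K)"
    using encoded_sphere.card_odd_vertices_G[OF enc] by simp
  then show ?thesis
    using encoded_sphere.sphere_triangulation_G[OF enc] encoded_sphere.subtriangulation_G[OF enc inj] T S(2) by blast
qed

section \<open>Strips without interior vertices\<close>

lemma path_graph_nth:
  assumes "path_graph E"
  obtains xs where "distinct xs" "2 \<le> length xs" "E = (\<lambda>i. {xs ! i, xs ! Suc i}) ` {..<length xs - 1}"
proof -
  obtain xs where xs: "distinct xs" "2 \<le> length xs" "E = {{xs ! i, xs ! Suc i} | i. Suc i < length xs}"
    using assms unfolding path_graph_def by blast
  have "E = (\<lambda>i. {xs ! i, xs ! Suc i}) ` {..<length xs - 1}"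
    unfolding xs(3) by (auto simp: less_diff_conv)
  with xs(1,2) show ?thesis
    by (rule that)
qed

lemma card_path_graph:
  assumes "path_graph E"
  shows "card (\<Union>E) = Suc (card E)"
proof -
  obtain xs where xs: "distinct xs" "2 \<le> length xs" "E = (\<lambda>i. {xs ! i, xs ! Suc i}) ` {..<length xs - 1}"
    using assms by (rule path_graph_nth)
  have "inj_on (\<lambda>i. {xs ! i, xs ! Suc i}) {..<length xs - 1}"
    by (rule inj_onI) (auto simp: doubleton_eq_iff nth_eq_iff_index_eq[OF xs(1)])
  then have "card E = length xs - 1"
    unfolding xs(3) by (simp add: card_image)
  moreover have "\<Union>E = set xs"
  proof (intro equalityI subsetI)
    fix x
    assume "x \<in> set xs"
    then obtain j where j: "j < length xs" "x = xs ! j"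
      by (metis in_set_conv_nth)
    show "x \<in> \<Union>E"
    proof (cases j)
      case 0
      then have "x \<in> {xs ! 0, xs ! Suc 0}" "0 \<in> {..<length xs - 1}"
        using j xs(2) by auto
      then show ?thesis
        unfolding xs(3) by blast
    next
      case (Suc i)
      then have "x \<in> {xs ! i, xs ! Suc i}" "i \<in> {..<length xs - 1}"
        using j by auto
      then show ?thesis
        unfolding xs(3) by blast
    qed
  qed (auto simp: xs(3))
  ultimately show ?thesis
    using xs(1,2) by (simp add: distinct_card)
qed

lemma path_graph_three_edges:
  assumes "path_graph E" and "{y, a} \<in> E" "{y, b} \<in> E" "{y, c} \<in> E"
  shows "a = b \<or> a = c \<or> b = c"
proof -
  obtain xs where xs: "distinct xs" "E = (\<lambda>i. {xs ! i, xs ! Suc i}) ` {..<length xs - 1}"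
    using assms(1) by (rule path_graph_nth)
  have "\<exists>i j. i < length xs \<and> j < length xs \<and> y = xs ! i \<and> z = xs ! j \<and> (j = Suc i \<or> i = Suc j)"
    if yz: "{y, z} \<in> E" for z
  proof -
    obtain k where k: "k < length xs - 1" "{y, z} = {xs ! k, xs ! Suc k}"
      using yz xs(2) by blast
    then have "k < length xs" "Suc k < length xs"
      by simp_all
    then show ?thesis
      using k(2) unfolding doubleton_eq_iff by metis
  qed
  note neighbour = this
  obtain i1 j1 where 1: "i1 < length xs" "y = xs ! i1" "a = xs ! j1" "j1 = Suc i1 \<or> i1 = Suc j1"
    using neighbour[OF assms(2)] by blast
  obtain i2 j2 where 2: "i2 < length xs" "y = xs ! i2" "b = xs ! j2" "j2 = Suc i2 \<or> i2 = Suc j2"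
    using neighbour[OF assms(3)] by blast
  obtain i3 j3 where 3: "i3 < length xs" "y = xs ! i3" "c = xs ! j3" "j3 = Suc i3 \<or> i3 = Suc j3"
    using neighbour[OF assms(4)] by blast
  have "i1 = i2" "i1 = i3"
    using nth_eq_iff_index_eq[OF xs(1)] 1 2 3 by simp_all
  then have "j1 = j2 \<or> j1 = j3 \<or> j2 = j3"
    using 1(4) 2(4) 3(4) by linarith
  with \<open>a = xs ! j1\<close> \<open>b = xs ! j2\<close> \<open>c = xs ! j3\<close> show ?thesis
    by blast
qed

context
  fixes K :: "'v set set"
  assumes disc: "triangulated_disc K" and no_interior: "interior_vertices K = {}"
begin

lemma disc_finite: "finite K" and disc_card: "t \<in> K \<Longrightarrow> card t = 3"
  using disc by (auto simp: triangulated_disc_def)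

lemma path_link: "x \<in> \<Union>K \<Longrightarrow> path_graph (link_of x K)"
  using disc no_interior unfolding triangulated_disc_def interior_vertices_def by blast

lemma finite_disc_vertices: "finite (\<Union>K)"
  using disc_finite disc_card by (metis card.infinite finite_Union zero_neq_numeral)

text \<open>Let \<open>V\<close>, \<open>E\<close>, \<open>F\<close> be the numbers of vertices, edges and triangles. Every link is a path, so every vertex lies
on one edge more than triangles. Summing over the vertices gives \<open>2 E = 3 F + V\<close>, and with
\<open>V - E + F = 1\<close> this becomes \<open>V = F + 2\<close>.\<close>
lemma card_Union_disc: "card (\<Union>K) = card K + 2"
proof -
  let ?V = "\<Union>K" and ?E = "edges_of K"
  have "?E \<subseteq> Pow ?V"
    unfolding edges_of_def by blast
  then have finite_E: "finite ?E"
    using finite_disc_vertices finite_subset by blast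
  have degrees: "card {E \<in> ?E. x \<in> E} = Suc (card {t \<in> K. x \<in> t})" if x: "x \<in> ?V" for x
  proof -
    have "link_of x K = (\<lambda>t. t - {x}) ` {t \<in> K. x \<in> t}"
      unfolding link_of_def by blast
    moreover have "inj_on (\<lambda>t. t - {x}) {t \<in> K. x \<in> t}"
      by (rule inj_onI) blast
    ultimately have "card (link_of x K) = card {t \<in> K. x \<in> t}"
      by (simp add: card_image)
    moreover have "card (\<Union>(link_of x K)) = card {E \<in> ?E. x \<in> E}"
    proof (rule bij_betw_same_card[of "\<lambda>y. {x, y}"], rule bij_betw_imageI)
      show "inj_on (\<lambda>y. {x, y}) (\<Union>(link_of x K))"
        by (rule inj_onI) (auto simp: doubleton_eq_iff)
      show "(\<lambda>y. {x, y}) ` \<Union>(link_of x K) = {E \<in> ?E. x \<in> E}"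
      proof (intro equalityI subsetI)
        fix E
        assume "E \<in> (\<lambda>y. {x, y}) ` \<Union>(link_of x K)"
        then obtain y t where "E = {x, y}" "t \<in> K" "x \<in> t" "y \<in> t" "y \<noteq> x"
          unfolding link_of_def by blast
        then show "E \<in> {E \<in> ?E. x \<in> E}"
          unfolding edges_of_def by auto
      next
        fix E
        assume "E \<in> {E \<in> ?E. x \<in> E}"
        then obtain t where t: "card E = 2" "t \<in> K" "E \<subseteq> t" "x \<in> E"
          unfolding edges_of_def by blast
        then obtain y where "E = {x, y}" "y \<noteq> x"
          by (metis card_2_iff doubleton_eq_iff insertE singletonD)
        then show "E \<in> (\<lambda>y. {x, y}) ` \<Union>(link_of x K)"
          using t unfolding link_of_def by blast
      qed
    qed
    ultimately show ?thesis
      using card_path_graph[OF path_link[OF x]] by simp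
  qed
  have "(\<Sum>x\<in>?V. card {E \<in> ?E. x \<in> E}) = 2 * card ?E"
  proof (rule sum_multicount[OF finite_disc_vertices finite_E], rule ballI)
    fix E
    assume "E \<in> ?E"
    then have "card E = 2" "{x \<in> ?V. x \<in> E} = E"
      unfolding edges_of_def by auto
    then show "card {x \<in> ?V. x \<in> E} = 2"
      by simp
  qed
  moreover have "(\<Sum>x\<in>?V. card {t \<in> K. x \<in> t}) = 3 * card K"
  proof (rule sum_multicount[OF finite_disc_vertices disc_finite], rule ballI)
    fix t
    assume "t \<in> K"
    then have "card t = 3" "{x \<in> ?V. x \<in> t} = t"
      using disc_card by auto
    then show "card {x \<in> ?V. x \<in> t} = 3"
      by simp
  qed
  moreover have "(\<Sum>x\<in>?V. card {E \<in> ?E. x \<in> E}) = (\<Sum>x\<in>?V. card {t \<in> K. x \<in> t}) + card ?V"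
    using degrees by (simp add: sum.distrib[symmetric] sum_Suc)
  moreover have "int (card ?V) - int (card ?E) + int (card K) = 1"
    using disc by (simp add: triangulated_disc_def)
  ultimately show ?thesis
    by linarith
qed

text \<open>Three triangles on the edge \<open>{x, y}\<close> would give \<open>y\<close> three neighbours in the link of \<open>x\<close>, which is a path.\<close>
lemma edge_in_two_triangles:
  assumes "card E = 2" and "E \<subseteq> s" "E \<subseteq> t" "E \<subseteq> r" and "s \<in> K" "t \<in> K" "r \<in> K"
  shows "s = t \<or> s = r \<or> t = r"
proof -
  obtain x y where xy: "E = {x, y}" "x \<noteq> y"
    using assms(1) by (meson card_2_iff)
  have third: "\<exists>z. q = {x, y, z} \<and> {y, z} \<in> link_of x K" if q: "q \<in> K" "E \<subseteq> q" for q
  proof -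
    have "card (q - {x, y}) = 1"
      using q xy disc_card[OF q(1)] by (simp add: card_Diff_subset)
    then obtain z where z: "q - {x, y} = {z}"
      by (meson card_1_singletonE)
    then have "q = {x, y, z}" "q - {x} = {y, z}"
      using q xy by blast+
    moreover from this have "q - {x} \<in> link_of x K"
      using q unfolding link_of_def by blast
    ultimately show ?thesis
      by auto
  qed
  obtain a b c where "s = {x, y, a}" "{y, a} \<in> link_of x K" "t = {x, y, b}" "{y, b} \<in> link_of x K"
    "r = {x, y, c}" "{y, c} \<in> link_of x K"
    using third assms by metis
  moreover have "path_graph (link_of x K)"
    using path_link assms(2,5) xy(1) by blast
  ultimately show ?thesis
    using path_graph_three_edges by metis
qed

end

text \<open>The first triangle has three vertices and every later one adds at most one, since it shares an edge with its
predecessor. In total there are \<open>length \<Delta> + 2\<close> vertices, so none of the later triangles can fail to add one.\<close>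
lemma strip_new_vertex:
  assumes triangles: "\<forall>t\<in>set \<Delta>. card t = 3"
    and shared: "\<forall>i. Suc i < length \<Delta> \<longrightarrow> card (\<Delta> ! i \<inter> \<Delta> ! Suc i) = 2"
    and vertices: "card (\<Union>(set \<Delta>)) = length \<Delta> + 2"
    and i: "Suc i < length \<Delta>"
  shows "\<exists>y. y \<notin> \<Union>(set (take (Suc i) \<Delta>)) \<and> \<Delta> ! Suc i = insert y (\<Delta> ! i \<inter> \<Delta> ! Suc i)"
proof -
  define c where "c k = card (\<Union>(set (take k \<Delta>)))" for k
  have fin: "finite t" if "t \<in> set \<Delta>" for t
    using triangles that by (metis card.infinite zero_neq_numeral)
  have fins: "finite (\<Union>(set (take k \<Delta>)))" for k
    using fin by (auto dest: in_set_takeD)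
  have new: "\<exists>y. \<Delta> ! Suc j = insert y (\<Delta> ! j \<inter> \<Delta> ! Suc j)" if j: "Suc j < length \<Delta>" for j
  proof -
    have "card (\<Delta> ! Suc j - \<Delta> ! j \<inter> \<Delta> ! Suc j) = 1"
      using shared triangles j fin by (subst card_Diff_subset) auto
    then obtain y where "\<Delta> ! Suc j - \<Delta> ! j \<inter> \<Delta> ! Suc j = {y}"
      by (meson card_1_singletonE)
    then show ?thesis
      by blast
  qed
  have union: "\<Union>(set (take (Suc (Suc j)) \<Delta>)) = insert y (\<Union>(set (take (Suc j) \<Delta>)))"
    if "Suc j < length \<Delta>" "\<Delta> ! Suc j = insert y (\<Delta> ! j \<inter> \<Delta> ! Suc j)" for j y
  proof -
    have "set (take (Suc (Suc j)) \<Delta>) = insert (\<Delta> ! Suc j) (set (take (Suc j) \<Delta>))"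
      using that(1) by (simp add: take_Suc_conv_app_nth insert_commute)
    moreover have "\<Delta> ! j \<in> set (take (Suc j) \<Delta>)"
      using that(1) by (simp add: take_Suc_conv_app_nth)
    ultimately show ?thesis
      using that(2) by blast
  qed
  have step: "c (Suc (Suc j)) \<le> Suc (c (Suc j))" if "Suc j < length \<Delta>" for j
  proof -
    obtain y where "\<Delta> ! Suc j = insert y (\<Delta> ! j \<inter> \<Delta> ! Suc j)"
      using new[OF \<open>Suc j < length \<Delta>\<close>] by blast
    then show ?thesis
      using union[OF that] fins unfolding c_def by (simp add: card_insert_if)
  qed
  have upper: "c (Suc j) \<le> j + 3" if "j < length \<Delta>" for j
    using that
  proof (induction j)
    case 0
    then have "c (Suc 0) = 3"
      using triangles by (simp add: c_def take_Suc_conv_app_nth)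
    then show ?case
      by simp
  next
    case (Suc j)
    then show ?case
      using step[of j] by simp
  qed
  have later: "c (Suc (j + k)) \<le> c (Suc j) + k" if "j + k < length \<Delta>" for j k
    using that
  proof (induction k)
    case (Suc k)
    then show ?case
      using step[of "j + k"] by simp
  qed simp
  obtain y where y: "\<Delta> ! Suc i = insert y (\<Delta> ! i \<inter> \<Delta> ! Suc i)"
    using new[OF i] by blast
  have "y \<notin> \<Union>(set (take (Suc i) \<Delta>))"
  proof
    assume "y \<in> \<Union>(set (take (Suc i) \<Delta>))"
    then have "c (Suc (Suc i)) \<le> i + 3"
      using union[OF i y] upper[of i] i unfolding c_def by (simp add: insert_absorb)
    moreover have "c (length \<Delta>) = length \<Delta> + 2"
      using vertices by (simp add: c_def)
    moreover obtain k where k: "length \<Delta> = Suc (Suc i) + k"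
      using i by (metis Suc_leI le_iff_add)
    then have "c (length \<Delta>) \<le> c (Suc (Suc i)) + k"
      using later[of "Suc i" k] by simp
    ultimately show False
      using k by linarith
  qed
  with y show ?thesis
    by blast
qed

section \<open>Growing a sphere along the strip\<close>

lemma coned_polygon_split:
  assumes "3 \<le> N"
  shows "coned_polygon N p =
    insert {p 0, p 1, p 2} (insert {p 0, p N, p 1} ((\<lambda>i. {p 0, p i, p (Suc i)}) ` {2..<N}))"
proof -
  have "{1..N} = insert 1 (insert N {2..<N})"
    using assms by auto
  then have "coned_polygon N p = (\<lambda>i. {p 0, p i, p (i mod N + 1)}) ` insert 1 (insert N {2..<N})"
    unfolding coned_polygon_def by blast
  also have "\<dots> = insert {p 0, p 1, p 2} (insert {p 0, p N, p 1} ((\<lambda>i. {p 0, p i, p (i mod N + 1)}) ` {2..<N}))"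
    using assms by (simp add: numeral_2_eq_2)
  also have "(\<lambda>i. {p 0, p i, p (i mod N + 1)}) ` {2..<N} = (\<lambda>i. {p 0, p i, p (Suc i)}) ` {2..<N}"
    by (rule image_cong) auto
  finally show ?thesis .
qed

text \<open>Vertices \<open>Inl x\<close> are those of the given triangulation, \<open>Inr 0\<close> is the outer vertex, and the other
\<open>Inr k\<close> serve as dummy vertices.\<close>
abbreviation outer :: "'v + nat" where
  "outer \<equiv> Inr 0"

text \<open>The state between two fans: the edge \<open>E\<close> faces the outer vertex, and the odd vertices are the
first centre \<open>c0\<close> and the outer vertex. \<open>U\<close> records the given vertices that have been used, and \<open>D\<close> given
triangles that are already present.\<close>
definition exposed_edge :: "'v \<Rightarrow> 'v set \<Rightarrow> 'v set \<Rightarrow> 'v set set \<Rightarrow> ('v + nat) set set \<Rightarrow> bool" where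
  "exposed_edge c0 E U D K \<longleftrightarrow> sphere K \<and> odd_set K = {Inl c0, outer} \<and> Inl -` \<Union>K = U \<and>
     (\<forall>t\<in>D. Inl ` t \<in> K) \<and> insert outer (Inl ` E) \<in> K"

text \<open>The state inside the fan around \<open>z\<close>: \<open>t\<close> is its latest triangle, entered through the edge \<open>e\<close>. The last two
clauses keep the exits of \<open>t\<close> usable. Behind an edge \<open>{z, p}\<close> lies a dummy vertex \<open>x\<close> such that the edge
from \<open>p\<close> to \<open>x\<close> separates \<open>z\<close> from the outer vertex, ready to be subdivided; the edge opposite to \<open>z\<close>
faces the outer vertex.\<close>
definition open_fan :: "'v \<Rightarrow> 'v \<Rightarrow> 'v set \<Rightarrow> 'v set \<Rightarrow> 'v set \<Rightarrow> 'v set set \<Rightarrow> ('v + nat) set set \<Rightarrow> bool" where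
  "open_fan c0 z t e U D K \<longleftrightarrow> sphere K \<and> odd_set K \<in> {{Inl c0, outer}, {Inl c0, Inl z}} \<and> Inl -` \<Union>K = U \<and>
     (\<forall>t\<in>D. Inl ` t \<in> K) \<and> z \<in> t \<and> z \<noteq> c0 \<and> card t = 3 \<and>
     (\<forall>p\<in>t - {z}. {z, p} \<noteq> e \<longrightarrow>
       (\<exists>x. {Inl p, Inr x, Inl z} \<in> K \<and> {Inl p, Inr x, outer} \<in> K)) \<and>
     (t - {z} \<noteq> e \<longrightarrow> insert outer (Inl ` (t - {z})) \<in> K)"

lemma fresh_Inr:
  assumes "sphere (K :: ('v + nat) set set)"
  shows "\<exists>x. Inr x \<notin> \<Union>K"
proof -
  have "finite (\<Union>K)"
  proof -
    obtain S where "oriented_sphere S" "triangles S = K"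
      using assms sphere_def by blast
    then show ?thesis
      using oriented_sphere.Union_triangles oriented_sphere.finite_Domain_S by metis
  qed
  then have "finite (Inr -` \<Union>K)"
    by (simp add: finite_vimageI)
  then show ?thesis
    using ex_new_if_finite[of "Inr -` \<Union>K"] by auto
qed

lemma Inl_image_neq: "Inr x \<in> s \<Longrightarrow> Inl ` t \<noteq> s"
  by blast

text \<open>The first polygon is the cone over an odd cycle, and coning the other side of the cycle from the outer
vertex yields a sphere in which only the two apexes are odd.\<close>
lemma exposed_edge_first_polygon:
  fixes u :: "nat \<Rightarrow> 'v"
  assumes "m \<ge> 1" and inj: "inj_on u {0..2*m+1}"
  shows "\<exists>K. exposed_edge (u 0) {u 1, u 2} (u ` {0..2*m+1}) (coned_polygon (2*m+1) u) K"
proof -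
  define N where "N = 2*m+1"
  have N: "3 \<le> N" "odd N"
    using assms(1) by (simp_all add: N_def)
  define f where "f i = (Inl (u i) :: 'v + nat)" for i
  have f_eq: "f i = f j \<longleftrightarrow> i = j" if "i \<le> N" "j \<le> N" for i j
    using inj_on_eq_iff[OF inj] that by (simp add: f_def N_def)
  have "distinct [f 0, outer, f 1, f 2, f N]"
    using N f_eq by (auto simp: f_def)
  then obtain B where B: "sphere B" "odd_set B = {f 0, outer}" "\<Union>B = {f 0, outer, f 1, f 2, f N}"
    "{{f 0, f 1, f 2}, {outer, f 1, f 2}, {f 0, f 2, f N}, {outer, f 2, f N}, {f 0, f N, f 1}, {outer, f N, f 1}} \<subseteq> B"
    using sphere_bipyramid by metis
  have "inj_on f {2..N}"
    using f_eq by (intro inj_onI) simp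
  moreover have "f i \<notin> \<Union>B" if "3 \<le> i" "i < N" for i
    using that f_eq[of i 0] f_eq[of i 1] f_eq[of i 2] f_eq[of i N] by (auto simp: B(3) f_def)
  moreover have "{f 0, f 2, f N} \<in> B" "{outer, f 2, f N} \<in> B" "f 0 \<noteq> outer"
    using B(4) by (simp_all add: f_def)
  ultimately obtain K where K: "sphere K" "B - {{f 0, f 2, f N}, {outer, f 2, f N}} \<subseteq> K"
    "\<forall>i\<in>{2..<N}. {f 0, f i, f (Suc i)} \<in> K" "\<Union>K = \<Union>B \<union> f ` {3..<N}" "odd_set K = odd_set B"
    using fan_between[OF B(1), of "f 0" f N outer] N by auto
  have ne: "f 1 \<noteq> f 0" "f 1 \<noteq> f 2" "f 1 \<noteq> f N" "f 1 \<noteq> outer"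
    using f_eq N by (auto simp: f_def)
  have kept: "{f 0, f 1, f 2} \<in> K" "{outer, f 1, f 2} \<in> K" "{f 0, f N, f 1} \<in> K"
  proof -
    have "s \<in> K" if "f 1 \<in> s" "s \<in> B" for s
    proof -
      have "s \<notin> {{f 0, f 2, f N}, {outer, f 2, f N}}"
        using that ne by blast
      then show ?thesis
        using that(2) K(2) by blast
    qed
    then show "{f 0, f 1, f 2} \<in> K" "{outer, f 1, f 2} \<in> K" "{f 0, f N, f 1} \<in> K"
      using B(4) by simp_all
  qed
  have "Inl -` \<Union>K = u ` {0..N}"
  proof -
    have "{0..N} = {0, 1, 2, N} \<union> {3..<N}"
      using N by auto
    then have "u ` {0..N} = {u 0, u 1, u 2, u N} \<union> u ` {3..<N}"
      by (simp add: image_Un)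
    moreover have "Inl -` (f ` {3..<N}) = u ` {3..<N}"
      by (auto simp: f_def)
    ultimately show ?thesis
      unfolding K(4) B(3) by (auto simp: f_def)
  qed
  moreover have "\<forall>t\<in>coned_polygon N u. Inl ` t \<in> K"
    unfolding coned_polygon_split[OF N(1)] using kept K(3) by (simp add: f_def)
  ultimately have "exposed_edge (u 0) {u 1, u 2} (u ` {0..N}) (coned_polygon N u) K"
    unfolding exposed_edge_def using K(1,5) B(2) kept(2) by (simp add: f_def)
  then show ?thesis
    unfolding N_def by blast
qed

text \<open>The second polygon is attached as an ear with centre \<open>v 0\<close>, the polygon vertex \<open>v (2 * n + 1)\<close> taking the part
of the dummy, and then filled up. The outer vertex becomes even and \<open>v 0\<close> odd.\<close>
lemma second_polygon:
  fixes v :: "nat \<Rightarrow> 'v"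
  assumes "n \<ge> 1" and inj: "inj_on v {0..2*n+1}" and exposed: "exposed_edge c0 {v 1, v 2} U D K"
    and fresh: "v ` {0..2*n+1} \<inter> U \<subseteq> {v 1, v 2}"
  shows "\<exists>K' :: ('v + nat) set set. sphere K' \<and> odd_set K' = {Inl c0, Inl (v 0)} \<and> (\<forall>t\<in>D \<union> coned_polygon (2*n+1) v. Inl ` t \<in> K')"
proof -
  define N where "N = 2*n+1"
  have N: "3 \<le> N" "odd N"
    using assms(1) by (simp_all add: N_def)
  define f where "f i = (Inl (v i) :: 'v + nat)" for i
  have f_eq: "f i = f j \<longleftrightarrow> i = j" if "i \<le> N" "j \<le> N" for i j
    using inj_on_eq_iff[OF inj] that by (simp add: f_def N_def)
  have K: "sphere K" "odd_set K = {Inl c0, outer}" "Inl -` \<Union>K = U" "\<forall>t\<in>D. Inl ` t \<in> K" "{outer, f 1, f 2} \<in> K"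
    using exposed unfolding exposed_edge_def by (simp_all add: f_def)
  have f_fresh: "f i \<notin> \<Union>K" if "i \<le> N" "i \<noteq> 1" "i \<noteq> 2" for i
  proof
    assume "f i \<in> \<Union>K"
    then have "v i \<in> U"
      using K(3) unfolding f_def by blast
    then have "v i \<in> {v 1, v 2}"
      using fresh that(1) unfolding N_def by (metis IntI atLeastAtMost_iff image_eqI le0 subsetD)
    then show False
      using f_eq[of i 1] f_eq[of i 2] that N by (auto simp: f_def)
  qed
  have fresh0N: "f 0 \<notin> \<Union>K" "f N \<notin> \<Union>K" "f 0 \<noteq> f N"
    using f_fresh f_eq N by simp_all
  note ear_args = K(1,5) fresh0N
  define L where "L = K - {{outer, f 1, f 2}} \<union>
    {{f 0, f 1, f 2}, {f N, f 1, f 0}, {f N, f 1, outer}, {f N, f 2, f 0}, {f N, f 2, outer}}"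
  have L: "sphere L" "odd_set L = {Inl c0, f 0}" "\<Union>L = insert (f 0) (insert (f N) (\<Union>K))"
  proof -
    show "sphere L"
      unfolding L_def by (rule ear(1)[OF ear_args])
    show "\<Union>L = insert (f 0) (insert (f N) (\<Union>K))"
      unfolding L_def by (rule Union_ear[OF K(5)])
    have "f 0 \<notin> odd_set K"
      using degree_outside[OF fresh0N(1)] by (simp add: odd_set_def)
    then show "odd_set L = {Inl c0, f 0}"
      unfolding L_def odd_set_ear[OF ear_args] K(2) by (auto simp: f_def)
  qed
  have "inj_on f {2..N}"
    using f_eq by (intro inj_onI) simp
  moreover have "f i \<notin> \<Union>L" if "3 \<le> i" "i < N" for i
    unfolding L(3) using that f_eq[of i 0] f_eq[of i N] f_fresh[of i] by simp
  moreover have "{f 0, f 2, f N} \<in> L" "{outer, f 2, f N} \<in> L" "f 0 \<noteq> outer"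
    unfolding L_def by (simp_all add: f_def insert_commute)
  ultimately obtain M where M: "sphere M" "L - {{f 0, f 2, f N}, {outer, f 2, f N}} \<subseteq> M"
    "\<forall>i\<in>{2..<N}. {f 0, f i, f (Suc i)} \<in> M" "odd_set M = odd_set L"
    using fan_between[OF L(1), of "f 0" f N outer] N by auto
  have ne: "f 1 \<noteq> f 0" "f 1 \<noteq> f 2" "f 1 \<noteq> f N" "f 1 \<noteq> outer"
    using f_eq N by (auto simp: f_def)
  have kept: "s \<in> M" if "s \<in> L" "f 1 \<in> s \<or> f N \<notin> s" for s
  proof -
    have "s \<notin> {{f 0, f 2, f N}, {outer, f 2, f N}}"
      using that(2) ne by blast
    then show ?thesis
      using that(1) M(2) by blast
  qed
  have "{f 0, f 1, f 2} \<in> M" "{f 0, f N, f 1} \<in> M"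
    by (rule kept; simp add: L_def insert_commute)+
  then have "\<forall>t\<in>coned_polygon N v. Inl ` t \<in> M"
    unfolding coned_polygon_split[OF N(1)] using M(3) by (simp add: f_def)
  moreover have "Inl ` t \<in> M" if "t \<in> D" for t
  proof (rule kept)
    have "Inl ` t \<in> K"
      using K(4) that by blast
    moreover have "Inl ` t \<noteq> {outer, f 1, f 2}"
      by (rule Inl_image_neq[of 0]) simp
    ultimately show "Inl ` t \<in> L"
      unfolding L_def by simp
    show "f 1 \<in> Inl ` t \<or> f N \<notin> Inl ` t"
      using \<open>Inl ` t \<in> K\<close> fresh0N(2) by blast
  qed
  ultimately have "sphere M \<and> odd_set M = {Inl c0, Inl (v 0)} \<and> (\<forall>t\<in>D \<union> coned_polygon N v. Inl ` t \<in> M)"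
    using M(1,4) L(2) by (auto simp: f_def)
  then show ?thesis
    unfolding N_def ..
qed

text \<open>Leaving a fan through the edge opposite to its centre: the new vertex \<open>y\<close> is the next centre.\<close>
lemma open_fan_start:
  assumes exposed: "exposed_edge c0 {p, q} U D K" and y: "y \<notin> U" and c0: "c0 \<in> U"
  shows "\<exists>K'. open_fan c0 y {y, p, q} {p, q} (insert y U) (insert {y, p, q} D) K'"
proof -
  have K: "sphere K" "odd_set K = {Inl c0, outer}" "Inl -` \<Union>K = U" "\<forall>t\<in>D. Inl ` t \<in> K" "{outer, Inl p, Inl q} \<in> K"
    using exposed unfolding exposed_edge_def by simp_all
  obtain x where x: "Inr x \<notin> \<Union>K"
    using fresh_Inr[OF K(1)] by blast
  have y': "(Inl y :: 'a + nat) \<notin> \<Union>K" "(Inl y :: 'a + nat) \<noteq> Inr x"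
    using K(3) y by auto
  note ear_args = K(1,5) y'(1) x y'(2)
  define L where "L = K - {{outer, Inl p, Inl q}} \<union>
    {{Inl y, Inl p, Inl q}, {Inr x, Inl p, Inl y}, {Inr x, Inl p, outer}, {Inr x, Inl q, Inl y}, {Inr x, Inl q, outer}}"
  have "sphere L"
    unfolding L_def by (rule ear(1)[OF ear_args])
  moreover have "Inl -` \<Union>L = insert y U"
    unfolding L_def Union_ear[OF K(5)] using K(3) by auto
  moreover have "odd_set L = {Inl c0, Inl y}"
  proof -
    have "Inl y \<notin> odd_set K"
      using degree_outside[OF y'(1)] by (simp add: odd_set_def)
    then show ?thesis
      unfolding L_def odd_set_ear[OF ear_args] K(2) by auto
  qed
  moreover have "Inl ` t \<in> L" if "t \<in> insert {y, p, q} D" for t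
  proof (cases "t = {y, p, q}")
    case True
    then show ?thesis
      by (simp add: L_def)
  next
    case False
    moreover have "Inl ` t \<noteq> {outer, Inl p, Inl q}"
      by (rule Inl_image_neq[of 0]) simp
    ultimately show ?thesis
      using that K(4) by (simp add: L_def)
  qed
  moreover have "y \<noteq> c0"
    using y c0 by blast
  moreover have pq: "p \<noteq> q" "y \<noteq> p" "y \<noteq> q"
  proof -
    have "Inl p \<in> \<Union>K" "Inl q \<in> \<Union>K"
      using K(5) by (meson UnionI insertCI)+
    then show "y \<noteq> p" "y \<noteq> q"
      using y'(1) by metis+
    show "p \<noteq> q"
      using sphere_distinct(2)[OF K(1,5)] by simp
  qed
  moreover have "\<exists>x. {Inl r, Inr x, Inl y} \<in> L \<and> {Inl r, Inr x, outer} \<in> L" if "r \<in> {p, q}" for r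
    using that unfolding L_def by (intro exI[of _ x]) (auto simp: insert_commute)
  moreover have "{y, p, q} - {y} = {p, q}"
    using pq by blast
  ultimately have "open_fan c0 y {y, p, q} {p, q} (insert y U) (insert {y, p, q} D) L"
    unfolding open_fan_def by auto
  then show ?thesis ..
qed

text \<open>The strip turns around \<open>z\<close> once more: the new vertex \<open>y\<close> subdivides the edge from \<open>p\<close> to the
dummy \<open>x\<close> and becomes the neighbour of \<open>p\<close> in the fan, while \<open>x\<close> stays behind it.\<close>
lemma open_fan_extend:
  assumes fan: "open_fan c0 z t e U D K" and p: "p \<in> t" "z \<noteq> p" "{z, p} \<noteq> e" and y: "y \<notin> U"
  shows "\<exists>K'. open_fan c0 z {y, z, p} {z, p} (insert y U) (insert {y, z, p} D) K'"
proof -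
  have K: "sphere K" "odd_set K \<in> {{Inl c0, outer}, {Inl c0, Inl z}}" "Inl -` \<Union>K = U" "\<forall>t\<in>D. Inl ` t \<in> K" "z \<noteq> c0"
    using fan unfolding open_fan_def by blast+
  obtain x where x: "{Inl p, Inr x, Inl z} \<in> K" "{Inl p, Inr x, outer} \<in> K"
    using fan p unfolding open_fan_def by blast
  have y': "(Inl y :: 'a + nat) \<notin> \<Union>K"
    using K(3) y by auto
  have zw: "(Inl z :: 'a + nat) \<noteq> outer"
    by simp
  define L where "L = K - {{Inl p, Inr x, Inl z}, {Inl p, Inr x, outer}} \<union>
    {{Inl y, Inl z, Inl p}, {Inl y, Inl z, Inr x}, {Inl y, outer, Inl p}, {Inl y, outer, Inr x}}"
  have "sphere L"
    unfolding L_def by (rule sphere_subdivide[OF K(1) x zw y'])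
  moreover have "Inl -` \<Union>L = insert y U"
    unfolding L_def Union_subdivide[OF x] using K(3) by auto
  moreover have "odd_set L \<in> {{Inl c0, outer}, {Inl c0, Inl z}}"
  proof -
    have "odd_set L = sym_diff (odd_set K) {Inl z, outer}"
      unfolding L_def by (rule odd_set_subdivide[OF K(1) x zw y'])
    moreover have "sym_diff {Inl c0, outer} {Inl z, outer} = {Inl c0, Inl z}"
      "sym_diff {Inl c0, Inl z} {Inl z, outer} = {Inl c0, outer}"
      using K(5) by auto
    ultimately show ?thesis
      using K(2) by (elim insertE) simp_all
  qed
  moreover have "Inl ` s \<in> L" if "s \<in> insert {y, z, p} D" for s
  proof (cases "s = {y, z, p}")
    case True
    then show ?thesis
      by (simp add: L_def)
  next
    case False
    moreover have "Inl ` s \<noteq> {Inl p, Inr x, Inl z}" "Inl ` s \<noteq> {Inl p, Inr x, outer}"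
      by (rule Inl_image_neq[of x]; simp)+
    ultimately show ?thesis
      using that K(4) by (simp add: L_def)
  qed
  moreover have pz: "y \<noteq> p" "y \<noteq> z"
  proof -
    have "Inl p \<in> \<Union>K" "Inl z \<in> \<Union>K"
      using x(1) by (meson UnionI insertCI)+
    then show "y \<noteq> p" "y \<noteq> z"
      using y' by metis+
  qed
  moreover have "{y, z, p} - {z} = {y, p}"
    using pz p(2) by blast
  moreover have "{Inl y, Inr x, Inl z} \<in> L" "{Inl y, Inr x, outer} \<in> L" "insert outer (Inl ` {y, p}) \<in> L"
    unfolding L_def by (simp_all add: insert_commute)
  ultimately have "open_fan c0 z {y, z, p} {z, p} (insert y U) (insert {y, z, p} D) L"
    unfolding open_fan_def using K(5) p(2) by auto
  then show ?thesis ..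
qed

text \<open>If \<open>z\<close> is still odd, one more dummy vertex in the edge behind an exit at \<open>z\<close> makes it even, at the expense of the
outer vertex. At least one of the two edges at \<open>z\<close> is not the entry \<open>e\<close>, so such an exit exists.\<close>
lemma open_fan_close:
  assumes fan: "open_fan c0 z t e U D K" and e: "t - {z} \<noteq> e"
  shows "\<exists>K'. exposed_edge c0 (t - {z}) U D K'"
proof -
  have K: "sphere K" "odd_set K \<in> {{Inl c0, outer}, {Inl c0, Inl z}}" "Inl -` \<Union>K = U" "\<forall>t\<in>D. Inl ` t \<in> K" "z \<noteq> c0"
    "card t = 3"
    using fan unfolding open_fan_def by blast+
  have "z \<in> t"
    using fan unfolding open_fan_def by blast
  then have "card (t - {z}) = 2"
    using K(6) by simp
  then obtain p q where pq: "t - {z} = {p, q}" "p \<noteq> q"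
    by (meson card_2_iff)
  then have z: "z \<noteq> p" "z \<noteq> q" "p \<in> t - {z}" "q \<in> t - {z}"
    by blast+
  have w: "{outer, Inl p, Inl q} \<in> K"
    using fan e pq(1) unfolding open_fan_def by simp
  have "\<exists>r x. {Inl r, Inr x, Inl z} \<in> K \<and> {Inl r, Inr x, outer} \<in> K"
  proof -
    have "{z, p} \<noteq> e \<or> {z, q} \<noteq> e"
      using pq(2) z by (auto simp: doubleton_eq_iff)
    then show ?thesis
      using fan z unfolding open_fan_def by blast
  qed
  then obtain r x where x: "{Inl r, Inr x, Inl z} \<in> K" "{Inl r, Inr x, outer} \<in> K"
    by blast
  show ?thesis
  proof (cases "odd_set K = {Inl c0, outer}")
    case True
    then have "exposed_edge c0 {p, q} U D K"
      unfolding exposed_edge_def using K w by simp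
    then show ?thesis
      unfolding pq(1) ..
  next
    case False
    then have odd: "odd_set K = {Inl c0, Inl z}"
      using K(2) by blast
    obtain y where y: "Inr y \<notin> \<Union>K"
      using fresh_Inr[OF K(1)] by blast
    have zw: "(Inl z :: 'a + nat) \<noteq> outer"
      by simp
    define L where "L = K - {{Inl r, Inr x, Inl z}, {Inl r, Inr x, outer}} \<union>
      {{Inr y, Inl z, Inl r}, {Inr y, Inl z, Inr x}, {Inr y, outer, Inl r}, {Inr y, outer, Inr x}}"
    have "sphere L"
      unfolding L_def by (rule sphere_subdivide[OF K(1) x zw y])
    moreover have "Inl -` \<Union>L = U"
      unfolding L_def Union_subdivide[OF x] using K(3) by auto
    moreover have "odd_set L = {Inl c0, outer}"
      unfolding L_def odd_set_subdivide[OF K(1) x zw y] odd using K(5) by auto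
    moreover have "Inl ` s \<in> L" if "s \<in> D" for s
    proof -
      have "Inl ` s \<noteq> {Inl r, Inr x, Inl z}" "Inl ` s \<noteq> {Inl r, Inr x, outer}"
        by (rule Inl_image_neq[of x]; simp)+
      then show ?thesis
        using that K(4) by (simp add: L_def)
    qed
    moreover have "{outer, Inl p, Inl q} \<in> L"
    proof -
      have "x \<noteq> 0"
        using sphere_distinct[OF K(1) x(2)] by auto
      then have "Inr x \<notin> {outer, Inl p, Inl q}"
        by simp
      then have "{outer, Inl p, Inl q} \<notin> {{Inl r, Inr x, Inl z}, {Inl r, Inr x, outer}}"
        by blast
      then show ?thesis
        using w unfolding L_def by blast
    qed
    ultimately have "exposed_edge c0 {p, q} U D L"
      unfolding exposed_edge_def by simp
    then show ?thesis
      unfolding pq(1) ..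
  qed
qed

section \<open>Colours along the strip and the extension theorem\<close>

text \<open>When it is reached, each triangle of the strip has exactly one uncoloured vertex, so only this case of the colouring rule occurs.\<close>
lemma colour_triangle_new:
  assumes "c y = None" and "c a = Some \<alpha>" "c b = Some \<beta>" and "a \<noteq> b"
  shows "colour_triangle {y, a, b} c = c(y \<mapsto> \<alpha> + \<beta>)"
proof -
  have "y \<noteq> a" "y \<noteq> b"
    using assms by auto
  then have "{y, a, b} - {y} = {a, b}"
    by blast
  then have sum: "(\<Sum>s\<in>{y, a, b} - {y}. the (c s)) = \<alpha> + \<beta>"
    using assms by simp
  have "colour_triangle {y, a, b} c x = (c(y \<mapsto> \<alpha> + \<beta>)) x" for x
  proof (cases "x = y")
    case True
    then show ?thesis
      using assms(1) sum by (simp only: colour_triangle_def) simp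
  next
    case False
    then have "\<not> (x \<in> {y, a, b} \<and> c x = None)"
      using assms by auto
    then show ?thesis
      using False unfolding colour_triangle_def by simp
  qed
  then show ?thesis ..
qed

lemma dom_fold_colour_triangle: "dom (fold colour_triangle ts c) = dom c \<union> \<Union>(set ts)"
proof (induction ts arbitrary: c)
  case (Cons t ts)
  have "dom (colour_triangle t c) = dom c \<union> t"
    by (auto simp: colour_triangle_def dom_def)
  then show ?case
    using Cons.IH by (simp add: Un_assoc)
qed simp

theorem proposition4p3:
  fixes m n :: nat and u v :: "nat \<Rightarrow> 'v" and \<Delta> :: "'v set list"
  assumes "m \<ge> 1" and "n \<ge> 1"
    and "connecting_strip m n u v \<Delta>"
    and "compatible_centers u v \<Delta>"
  shows "\<exists>(G :: (nat, nat) pre_digraph) arev rot.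
           sphere_triangulation G arev rot \<and>
           subtriangulation (connected_polygons m n u v \<Delta>) G arev rot \<and>
           card (odd_vertices G arev rot) = 2"
proof -
  let ?U = "u ` {0..2*m+1}" and ?V = "v ` {0..2*n+1}"
  have inj_u: "inj_on u {0..2*m+1}" and inj_v: "inj_on v {0..2*n+1}" and uv: "?U \<inter> ?V = {}"
    and distinct: "distinct \<Delta>"
    and shared: "\<forall>i. Suc i < length \<Delta> \<longrightarrow> card (\<Delta> ! i \<inter> \<Delta> ! Suc i) = 2"
    and disc: "triangulated_disc (set \<Delta>)" and no_interior: "interior_vertices (set \<Delta>) = {}"
    and \<Delta>_u: "\<Union>(set \<Delta>) \<inter> ?U = {u 1, u 2}" and boundary_u: "{u 1, u 2} \<in> boundary_edges (set \<Delta>)"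
    and hd_u: "{u 1, u 2} \<subseteq> hd \<Delta>"
    and \<Delta>_v: "\<Union>(set \<Delta>) \<inter> ?V = {v 1, v 2}" and boundary_v: "{v 1, v 2} \<in> boundary_edges (set \<Delta>)"
    and last_v: "{v 1, v 2} \<subseteq> last \<Delta>"
    using assms(3) unfolding connecting_strip_def by - (elim conjE, assumption)+
  have u_neq: "u 0 \<noteq> u 1" "u 0 \<noteq> u 2" "u 1 \<noteq> u 2" and v_neq: "v 0 \<noteq> v 1" "v 0 \<noteq> v 2" "v 1 \<noteq> v 2"
    using inj_on_eq_iff[OF inj_u] inj_on_eq_iff[OF inj_v] assms(1,2) by simp_all
  have u_in: "u 0 \<in> ?U" "u 1 \<in> ?U" "u 2 \<in> ?U" and v_in: "v 0 \<in> ?V" "v 1 \<in> ?V" "v 2 \<in> ?V"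
    using assms(1,2) by auto
  have disjoint: "x \<notin> ?V" if "x \<in> ?U" for x
    using that uv[unfolded disjoint_iff] by metis
  have triangles: "\<forall>t\<in>set \<Delta>. card t = 3"
    using disc by (simp add: triangulated_disc_def)
  have nonempty: "\<Delta> \<noteq> []"
    using boundary_u by (auto simp: boundary_edges_def)
  have "card (\<Union>(set \<Delta>)) = length \<Delta> + 2"
    using card_Union_disc[OF disc no_interior] distinct_card[OF distinct] by simp
  note new_vertex = strip_new_vertex[OF triangles shared this]
  have boundary: "s = t" if "E \<in> boundary_edges (set \<Delta>)" "s \<in> set \<Delta>" "t \<in> set \<Delta>" "E \<subseteq> s" "E \<subseteq> t" for E s t
    using that unfolding boundary_edges_def by blast
  define c\<^sub>0 where "c\<^sub>0 = [u 0 \<mapsto> 0 :: bit, u 1 \<mapsto> 1, u 2 \<mapsto> 1]"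
  define C where "C i = fold colour_triangle (take (Suc i) \<Delta>) c\<^sub>0" for i
  define E where "E i = (if i = 0 then {u 1, u 2} else \<Delta> ! (i - 1) \<inter> \<Delta> ! i)" for i
  define used where "used i = ?U \<union> \<Union>(set (take (Suc i) \<Delta>))" for i
  define placed where "placed i = coned_polygon (2*m+1) u \<union> set (take (Suc i) \<Delta>)" for i
  have dom_C: "dom (C i) = {u 0, u 1, u 2} \<union> \<Union>(set (take (Suc i) \<Delta>))" for i
    unfolding C_def dom_fold_colour_triangle by (auto simp: c\<^sub>0_def)
  have dom_used: "C i y = None" if "y \<notin> used i" for i y
  proof -
    have "y \<notin> dom (C i)"
      using that u_in unfolding dom_C used_def by blast
    then show ?thesis
      by blast
  qed
  have take_Suc: "set (take (Suc (Suc i)) \<Delta>) = insert (\<Delta> ! Suc i) (set (take (Suc i) \<Delta>))"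
    and C_Suc: "C (Suc i) = colour_triangle (\<Delta> ! Suc i) (C i)" if "Suc i < length \<Delta>" for i
    using that by (simp_all add: C_def take_Suc_conv_app_nth[of "Suc i"])
  have edge: "card (E i) = 2" if "i < length \<Delta>" for i
    using that shared u_neq by (auto simp: E_def elim: allE[of _ "i - 1"])
  \<comment> \<open>Otherwise a boundary edge would lie in two triangles, or an edge in three.\<close>
  have edges_differ: "E (Suc i) \<noteq> E i" if i: "Suc i < length \<Delta>" for i
  proof
    assume eq: "E (Suc i) = E i"
    have sub: "E (Suc i) \<subseteq> \<Delta> ! i" "E (Suc i) \<subseteq> \<Delta> ! Suc i"
      by (auto simp: E_def)
    have mem: "\<Delta> ! i \<in> set \<Delta>" "\<Delta> ! Suc i \<in> set \<Delta>" "\<Delta> ! i \<noteq> \<Delta> ! Suc i"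
      using i distinct by (auto simp: nth_eq_iff_index_eq)
    show False
    proof (cases i)
      case 0
      then have "E i = {u 1, u 2}"
        by (simp add: E_def)
      then show False
        using boundary[OF boundary_u mem(1,2)] sub mem(3) eq by metis
    next
      case (Suc j)
      then have "E (Suc i) \<subseteq> \<Delta> ! j" "\<Delta> ! j \<in> set \<Delta>" "\<Delta> ! j \<noteq> \<Delta> ! i" "\<Delta> ! j \<noteq> \<Delta> ! Suc i"
        using eq i distinct by (auto simp: E_def nth_eq_iff_index_eq)
      then show False
        using edge_in_two_triangles[OF disc no_interior edge[OF i]] sub mem by blast
    qed
  qed
  \<comment> \<open>The centre of the current fan is the vertex of colour 0 in the current triangle.\<close>
  have invariant: "\<exists>K z. open_fan (u 0) z (\<Delta> ! i) (E i) (used i) (placed i) K \<and> C i z = Some 0 \<and>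
      (\<forall>p\<in>\<Delta> ! i - {z}. C i p = Some 1)" if "i < length \<Delta>" for i
    using that
  proof (induction i)
    case 0
    have "\<Delta> ! 0 \<in> set \<Delta>" "{u 1, u 2} \<subseteq> \<Delta> ! 0"
      using nonempty hd_u by (simp_all add: hd_conv_nth)
    moreover from this have "card (\<Delta> ! 0 - {u 1, u 2}) = 1"
      using triangles u_neq by (simp add: card_Diff_subset)
    then obtain y where y: "\<Delta> ! 0 - {u 1, u 2} = {y}"
      by (meson card_1_singletonE)
    ultimately have first: "\<Delta> ! 0 = {y, u 1, u 2}" and "y \<in> \<Union>(set \<Delta>)" "y \<notin> {u 1, u 2}"
      by blast+
    then have y_new: "y \<notin> ?U"
      using \<Delta>_u by blast
    have take0: "take (Suc 0) \<Delta> = [\<Delta> ! 0]"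
      using nonempty by (simp add: take_Suc_conv_app_nth)
    obtain K where "exposed_edge (u 0) {u 1, u 2} ?U (coned_polygon (2*m+1) u) K"
      using exposed_edge_first_polygon[OF assms(1) inj_u] by blast
    then obtain K' where "open_fan (u 0) y {y, u 1, u 2} {u 1, u 2} (insert y ?U)
        (insert {y, u 1, u 2} (coned_polygon (2*m+1) u)) K'"
      using open_fan_start[OF _ y_new u_in(1)] by blast
    moreover have "insert y ?U = used 0"
      using u_in by (auto simp: used_def take0 first)
    moreover have "insert {y, u 1, u 2} (coned_polygon (2*m+1) u) = placed 0"
      by (auto simp: placed_def take0 first)
    ultimately have "open_fan (u 0) y (\<Delta> ! 0) (E 0) (used 0) (placed 0) K'"
      by (simp add: first E_def)
    moreover have "C 0 = c\<^sub>0(y \<mapsto> 1 + 1)"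
    proof -
      have "c\<^sub>0 y = None"
        using y_new u_in by (auto simp: c\<^sub>0_def)
      then show ?thesis
        unfolding C_def take0 first using colour_triangle_new[of c\<^sub>0 y "u 1" 1 "u 2" 1] u_neq
        by (simp add: c\<^sub>0_def)
    qed
    then have "C 0 y = Some 0" "C 0 (u 1) = Some 1" "C 0 (u 2) = Some 1"
      using \<open>y \<notin> {u 1, u 2}\<close> u_neq by (auto simp: c\<^sub>0_def)
    ultimately show ?case
      using first by auto
  next
    case (Suc i)
    then obtain K z where fan: "open_fan (u 0) z (\<Delta> ! i) (E i) (used i) (placed i) K"
      and C_z: "C i z = Some 0" and C_p: "\<And>p. p \<in> \<Delta> ! i - {z} \<Longrightarrow> C i p = Some 1"
      by auto
    obtain y where y: "y \<notin> \<Union>(set (take (Suc i) \<Delta>))" and next_t: "\<Delta> ! Suc i = insert y (E (Suc i))"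
      using new_vertex[OF Suc.prems] by (auto simp: E_def)
    have E_sub: "E (Suc i) \<subseteq> \<Delta> ! i"
      by (auto simp: E_def)
    note E_card = edge[OF Suc.prems]
    have "y \<notin> ?U"
    proof
      assume "y \<in> ?U"
      moreover have "y \<in> \<Union>(set \<Delta>)"
        using next_t Suc.prems by (metis UnionI insertI1 nth_mem)
      ultimately have "y \<in> hd \<Delta>"
        using \<Delta>_u hd_u by blast
      moreover have "hd \<Delta> \<in> set (take (Suc i) \<Delta>)"
        using nonempty by (cases \<Delta>) auto
      ultimately show False
        using y by blast
    qed
    with y have y_new: "y \<notin> used i"
      by (simp add: used_def)
    note C_y = dom_used[OF y_new]
    have "\<Delta> ! i \<subseteq> used i"
      using Suc.prems by (auto simp: used_def take_Suc_conv_app_nth)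
    have used: "insert y (used i) = used (Suc i)"
      unfolding used_def take_Suc[OF Suc.prems] next_t using \<open>\<Delta> ! i \<subseteq> used i\<close> E_sub
      by (auto simp: used_def)
    have placed: "insert (\<Delta> ! Suc i) (placed i) = placed (Suc i)"
      unfolding placed_def take_Suc[OF Suc.prems] by blast
    show ?case
    proof (cases "z \<in> E (Suc i)")
      case True
      then obtain p where p: "E (Suc i) = {z, p}" "z \<noteq> p"
        using E_card by (metis card_2_iff doubleton_eq_iff insertE singletonD)
      then have p_in: "p \<in> \<Delta> ! i" "p \<in> \<Delta> ! i - {z}"
        using E_sub by blast+
      obtain K' where "open_fan (u 0) z {y, z, p} {z, p} (insert y (used i)) (insert {y, z, p} (placed i)) K'"
        using open_fan_extend[OF fan p_in(1) p(2) _ y_new] edges_differ[OF Suc.prems] p(1) by metis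
      then have "open_fan (u 0) z (\<Delta> ! Suc i) (E (Suc i)) (used (Suc i)) (placed (Suc i)) K'"
        using used placed next_t p(1) by simp
      moreover have "C (Suc i) = (C i)(y \<mapsto> 0 + 1)"
        unfolding C_Suc[OF Suc.prems] next_t p(1)
        by (rule colour_triangle_new[OF C_y C_z C_p[OF p_in(2)] p(2)])
      moreover have "z \<noteq> y" "p \<noteq> y"
        using C_y C_z C_p[OF p_in(2)] by auto
      ultimately show ?thesis
        using C_z C_p[OF p_in(2)] next_t p(1) by (intro exI[of _ K'] exI[of _ z]) auto
    next
      case False
      have "z \<in> \<Delta> ! i" "card (\<Delta> ! i) = 3"
        using fan unfolding open_fan_def by blast+
      then have "card (\<Delta> ! i - {z}) = 2" "finite (\<Delta> ! i - {z})"
        by (simp_all add: card_ge_0_finite)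
      moreover have "E (Suc i) \<subseteq> \<Delta> ! i - {z}"
        using False E_sub by blast
      ultimately have E_rim: "\<Delta> ! i - {z} = E (Suc i)"
        using E_card card_subset_eq by metis
      obtain p q where pq: "E (Suc i) = {p, q}" "p \<noteq> q"
        using E_card by (meson card_2_iff)
      have "\<Delta> ! i - {z} \<noteq> E i"
        using E_rim edges_differ[OF Suc.prems] by simp
      then obtain L where "exposed_edge (u 0) {p, q} (used i) (placed i) L"
        using open_fan_close[OF fan] E_rim pq(1) by metis
      moreover have "u 0 \<in> used i"
        using u_in by (simp add: used_def)
      ultimately obtain K' where "open_fan (u 0) y {y, p, q} {p, q} (insert y (used i)) (insert {y, p, q} (placed i)) K'"
        using open_fan_start[OF _ y_new] by blast
      then have "open_fan (u 0) y (\<Delta> ! Suc i) (E (Suc i)) (used (Suc i)) (placed (Suc i)) K'"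
        using used placed next_t pq(1) by simp
      moreover have C_pq: "C i p = Some 1" "C i q = Some 1"
        using C_p E_rim pq(1) by blast+
      have "C (Suc i) = (C i)(y \<mapsto> 1 + 1)"
        unfolding C_Suc[OF Suc.prems] next_t pq(1)
        by (rule colour_triangle_new[OF C_y C_pq pq(2)])
      moreover have "p \<noteq> y" "q \<noteq> y"
        using C_y C_pq by auto
      ultimately show ?thesis
        using C_pq next_t pq(1) by (intro exI[of _ K'] exI[of _ y]) auto
    qed
  qed
  define r where "r = length \<Delta> - 1"
  have r: "r < length \<Delta>" "\<Delta> ! r = last \<Delta>" "take (Suc r) \<Delta> = \<Delta>"
    using nonempty by (simp_all add: r_def last_conv_nth)
  obtain K z where fan: "open_fan (u 0) z (\<Delta> ! r) (E r) (used r) (placed r) K"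
    and C_z: "C r z = Some 0" and C_p: "\<And>p. p \<in> \<Delta> ! r - {z} \<Longrightarrow> C r p = Some 1"
    using invariant[OF r(1)] by blast
  have v_last: "v 1 \<in> \<Delta> ! r" "v 2 \<in> \<Delta> ! r"
    using last_v r(2) by simp_all
  have v0_new: "v 0 \<notin> used r"
    using \<Delta>_v uv v_in v_neq unfolding used_def r(3) by blast
  \<comment> \<open>If the centre were an end of the last edge, the colours 0 and 1 of this edge would give \<open>v 0\<close> the colour 1.\<close>
  have "z \<notin> {v 1, v 2}"
  proof
    assume z: "z \<in> {v 1, v 2}"
    have "colour_triangle {u 0, u 1, u 2} c\<^sub>0 = c\<^sub>0"
      by (rule ext) (auto simp: colour_triangle_def c\<^sub>0_def)
    then have "induced_colouring u v \<Delta> = colour_triangle {v 0, v 1, v 2} (C r)"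
      unfolding induced_colouring_def c\<^sub>0_def[symmetric] C_def r(3) by simp
    also have "\<dots> = (C r)(v 0 \<mapsto> 1)"
    proof (cases "z = v 1")
      case True
      then have "C r (v 1) = Some 0" "C r (v 2) = Some 1"
        using C_z C_p[of "v 2"] v_last v_neq by auto
      then show ?thesis
        using colour_triangle_new[of "C r" "v 0" "v 1" 0 "v 2" 1] dom_used[OF v0_new] v_neq by simp
    next
      case False
      then have "C r (v 1) = Some 1" "C r (v 2) = Some 0"
        using z C_z C_p[of "v 1"] v_last v_neq by auto
      then show ?thesis
        using colour_triangle_new[of "C r" "v 0" "v 1" 1 "v 2" 0] dom_used[OF v0_new] v_neq by simp
    qed
    finally show False
      using assms(4) by (simp add: compatible_centers_def)
  qed
  have rim: "\<Delta> ! r - {z} = {v 1, v 2}"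
  proof -
    have "z \<in> \<Delta> ! r" "card (\<Delta> ! r) = 3"
      using fan unfolding open_fan_def by blast+
    then have "card (\<Delta> ! r - {z}) = 2" "finite (\<Delta> ! r - {z})"
      by (simp_all add: card_ge_0_finite)
    moreover have "{v 1, v 2} \<subseteq> \<Delta> ! r - {z}" "card {v 1, v 2} = 2"
      using v_last v_neq \<open>z \<notin> {v 1, v 2}\<close> by auto
    ultimately show ?thesis
      using card_subset_eq by metis
  qed
  \<comment> \<open>The last edge is a boundary edge of the strip, so it is not an entry shared with the previous triangle.\<close>
  have "{v 1, v 2} \<noteq> E r"
  proof
    assume eq: "{v 1, v 2} = E r"
    show False
    proof (cases r)
      case 0
      then have "v 1 \<in> {u 1, u 2}"
        using eq by (auto simp: E_def)
      then show False
        using disjoint[OF u_in(2)] disjoint[OF u_in(3)] v_in(2) by (metis insertE singletonD)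
    next
      case (Suc j)
      then have "{v 1, v 2} \<subseteq> \<Delta> ! j" "\<Delta> ! j \<in> set \<Delta>" "\<Delta> ! j \<noteq> \<Delta> ! r"
        using eq r(1) distinct by (auto simp: E_def nth_eq_iff_index_eq)
      moreover have "\<Delta> ! r \<in> set \<Delta>"
        using r(1) by simp
      ultimately show False
        using boundary[OF boundary_v] v_last by blast
    qed
  qed
  then obtain L where L: "exposed_edge (u 0) {v 1, v 2} (used r) (placed r) L"
    using open_fan_close[OF fan] rim by metis
  have "?V \<inter> used r \<subseteq> {v 1, v 2}"
  proof
    fix x
    assume "x \<in> ?V \<inter> used r"
    then have "x \<in> \<Union>(set \<Delta>) \<inter> ?V"
      using disjoint unfolding used_def r(3) by (metis IntE IntI UnE)
    then show "x \<in> {v 1, v 2}"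
      by (simp only: \<Delta>_v)
  qed
  then obtain M :: "('v + nat) set set" where M: "sphere M" "odd_set M = {Inl (u 0), Inl (v 0)}"
    "\<forall>t\<in>placed r \<union> coned_polygon (2*n+1) v. Inl ` t \<in> M"
    using second_polygon[OF assms(2) inj_v L] by blast
  have "placed r \<union> coned_polygon (2*n+1) v = connected_polygons m n u v \<Delta>"
    by (simp add: placed_def r(3) connected_polygons_def)
  then have "(\<lambda>t. Inl ` t) ` connected_polygons m n u v \<Delta> \<subseteq> M"
    using M(3) by auto
  moreover have "inj_on (Inl :: 'v \<Rightarrow> 'v + nat) (\<Union>(connected_polygons m n u v \<Delta>))"
    by simp
  moreover have "card (odd_set M) = 2"
  proof -
    have "u 0 \<noteq> v 0"
      using disjoint[OF u_in(1)] v_in(1) by metis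
    then show ?thesis
      by (simp add: M(2))
  qed
  ultimately show ?thesis
    using sphere_realization[OF M(1)] by metis
qed

end
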